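(* Let $m\ge1$ be an integer, let $a_0,\dots,a_m$ be real constants with $a_m\neq0$, and consider the multi-term fractional differential equation $$a_0x(t)+a_1\,{}_0^{C}\mathrm{D}_t^{\alpha_1}x(t)+a_2\,{}_0^{C}\mathrm{D}_t^{\alpha_2}x(t)+\dots+a_m\,{}_0^{C}\mathrm{D}_t^{\alpha_m}x(t)=0,\qquad\text{(E)}$$ where $k-1<\alpha_k\le k$ for $k=1,2,\dots,m$, subject to the initial conditions $x^{(i)}(0)=C_i$, $i=0,1,\dots,m-1$. Put $$\beta_{2j}=\alpha_{j+1}-j\quad (j=0,1,\dots,m-1),\qquad \beta_{2j+1}=(j+1)-\alpha_{j+1}\quad (j=0,1,\dots,m-2),$$ and suppose $0<\beta_k\le1$ for $k=0,1,\dots,2m-2$. Consider the system of $2m-1$ equations $$\begin{aligned} x(t)&=y_0(t),\\ {}_0^{C}\mathrm{D}_t^{\beta_j}y_j(t)&=y_{j+1}(t),\qquad j=0,1,\dots,2m-3,\\ {}_0^{C}\mathrm{D}_t^{\beta_{2m-2}}y_{2m-2}(t)&=\frac{-1}{a_m}\left[a_0x(t)+a_1y_1(t)+a_2y_3(t)+a_3y_5(t)+\dots+a_{m-1}y_{2m-3}(t)\right],\end{aligned}\qquad\text{(S)}$$ with initial conditions $y_0(0)=x(0)=C_0$ and $$y_{2i-1}(0)=0,\qquad y_{2i}(0)=x^{(i)}(0)=C_i,\qquad i=1,2,\dots,m-1.$$ Then the equation (E) is equivalent to the system (S).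
   Context: For $n-1<\alpha<n$, $n\in\mathbb{N}$, the Caputo fractional derivative with lower limit $0$ is $${}_0^{C}\mathrm{D}_t^{\alpha}f(t)=\frac{1}{\Gamma(n-\alpha)}\int_0^t(t-\tau)^{n-\alpha-1}f^{(n)}(\tau)\,d\tau,\qquad t>0,$$ and ${}_0^{C}\mathrm{D}_t^{n}f=f^{(n)}$; it is applied to functions $f$ on $[0,\infty)$ with $f^{(n-1)}$ absolutely continuous on each $[0,T]$. "Equivalent" means that the solution $x$ of (E) with its stated initial conditions coincides with the component $x=y_0$ of the solution of (S) with its stated initial conditions, for all initial data $C_0,\dots,C_{m-1}$ (equivalently, their Laplace transforms $X(s)$ and $Y_0(s)$ coincide). *)

theory Defs
  imports "HOL-Analysis.Analysis"
begin

(* Functions on [0,\<infinity>) are represented by total functions real => real whose values at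
   negative arguments are never used: derivatives are taken within {0..}, hence are
   one-sided at 0 and ordinary at every t > 0. *)
definition hderiv :: "nat \<Rightarrow> (real \<Rightarrow> real) \<Rightarrow> real \<Rightarrow> real" where
  "hderiv n f = ((\<lambda>g t. vector_derivative g (at t within {0..})) ^^ n) f"

(* The usual epsilon-delta definition; a finite family of non-overlapping compact
   subintervals is a division of its own union. *)
definition abs_continuous_on :: "real \<Rightarrow> real \<Rightarrow> (real \<Rightarrow> real) \<Rightarrow> bool" where
  "abs_continuous_on a b f \<longleftrightarrow>
     (\<forall>\<epsilon>>0. \<exists>\<delta>>0. \<forall>\<D>. \<D> division_of \<Union>\<D> \<and> \<Union>\<D> \<subseteq> {a..b} \<and> (\<Sum>K\<in>\<D>. Sup K - Inf K) < \<delta> \<longrightarrow>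
        (\<Sum>K\<in>\<D>. \<bar>f (Sup K) - f (Inf K)\<bar>) < \<epsilon>)"

(* For \<alpha> > 0, the n with n - 1 < \<alpha> <= n. *)
definition caputo_order :: "real \<Rightarrow> nat" where
  "caputo_order \<alpha> = nat \<lceil>\<alpha>\<rceil>"

definition caputo_class :: "real \<Rightarrow> (real \<Rightarrow> real) set" where
  "caputo_class \<alpha> = {f. let n = caputo_order \<alpha> in
     (\<forall>k<n - 1. \<forall>t\<ge>0. hderiv k f differentiable (at t within {0..})) \<and>
     (\<forall>T>0. abs_continuous_on 0 T (hderiv (n - 1) f))}"

(* The integral is with respect to lebesgue rather than lborel since f^(n) is in
   general determined only almost everywhere. *)
definition caputo :: "real \<Rightarrow> (real \<Rightarrow> real) \<Rightarrow> real \<Rightarrow> real" where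
  "caputo \<alpha> f t = (let n = caputo_order \<alpha> in
     if \<alpha> = real n then hderiv n f t
     else 1 / Gamma (real n - \<alpha>) *
       set_lebesgue_integral lebesgue {0..t}
         (\<lambda>\<tau>. (t - \<tau>) powr (real n - \<alpha> - 1) * hderiv n f \<tau>))"

(* Existence of the value at t > 0. It has to be stated separately, because an undefined
   derivative or integral still denotes some real number (0 for the integral). *)
definition caputo_exists :: "real \<Rightarrow> (real \<Rightarrow> real) \<Rightarrow> real \<Rightarrow> bool" where
  "caputo_exists \<alpha> f t \<longleftrightarrow> (let n = caputo_order \<alpha> in
     if \<alpha> = real n then hderiv (n - 1) f differentiable (at t within {0..})
     else set_integrable lebesgue {0..t}
         (\<lambda>\<tau>. (t - \<tau>) powr (real n - \<alpha> - 1) * hderiv n f \<tau>))"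

definition solves_multiterm ::
  "nat \<Rightarrow> (nat \<Rightarrow> real) \<Rightarrow> (nat \<Rightarrow> real) \<Rightarrow> (nat \<Rightarrow> real) \<Rightarrow> (real \<Rightarrow> real) \<Rightarrow> bool" where
  "solves_multiterm m a \<alpha> C x \<longleftrightarrow>
     (\<forall>k\<in>{1..m}. x \<in> caputo_class (\<alpha> k)) \<and>
     (\<forall>t>0. (\<forall>k\<in>{1..m}. caputo_exists (\<alpha> k) x t) \<and>
            a 0 * x t + (\<Sum>k=1..m. a k * caputo (\<alpha> k) x t) = 0) \<and>
     (\<forall>i<m. hderiv i x 0 = C i)"

definition solves_system ::
  "nat \<Rightarrow> (nat \<Rightarrow> real) \<Rightarrow> (nat \<Rightarrow> real) \<Rightarrow> (nat \<Rightarrow> real) \<Rightarrow>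
   (real \<Rightarrow> real) \<Rightarrow> (nat \<Rightarrow> real \<Rightarrow> real) \<Rightarrow> bool" where
  "solves_system m a \<beta> C x y \<longleftrightarrow>
     (\<forall>j\<le>2 * m - 2. y j \<in> caputo_class (\<beta> j)) \<and>
     (\<forall>t\<ge>0. x t = y 0 t) \<and>
     (\<forall>j<2 * m - 2. \<forall>t>0. caputo_exists (\<beta> j) (y j) t \<and> caputo (\<beta> j) (y j) t = y (j + 1) t) \<and>
     (\<forall>t>0. caputo_exists (\<beta> (2 * m - 2)) (y (2 * m - 2)) t \<and>
            caputo (\<beta> (2 * m - 2)) (y (2 * m - 2)) t =
              - 1 / a m * (a 0 * x t + (\<Sum>k=1..m - 1. a k * y (2 * k - 1) t))) \<and>
     y 0 0 = C 0 \<and>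
     (\<forall>i\<in>{1..m - 1}. y (2 * i - 1) 0 = 0 \<and> y (2 * i) 0 = C i)"

end

theory Submission
  imports Defs
begin

text \<open>
  Write \<open>I\<^sup>a\<close> for the Riemann--Liouville integral. An absolutely continuous \<open>f\<close> is the
  integral of its almost everywhere derivative, and for \<open>0 < \<beta> < 1\<close> its Caputo derivative is
  \<open>D\<^sup>\<beta> f = I\<^sup>1\<^sup>-\<^sup>\<beta> f'\<close>. By the semigroup law, \<open>D\<^sup>\<beta> f = \<phi>\<close> at all \<open>t > 0\<close> gives
  \<open>f = f(0) + I\<^sup>\<beta> \<phi>\<close>.

  Put \<open>\<beta> = \<beta>\<^sub>2\<^sub>i\<close> and \<open>\<gamma> = \<beta>\<^sub>2\<^sub>i\<^sub>+\<^sub>1 = 1 - \<beta>\<close>. A solution of the system satisfies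
  \<open>y\<^sub>2\<^sub>i = C\<^sub>i + I\<^sup>\<beta> y\<^sub>2\<^sub>i\<^sub>+\<^sub>1\<close> and, the initial value being zero,
  \<open>y\<^sub>2\<^sub>i\<^sub>+\<^sub>1 = I\<^sup>\<gamma> y\<^sub>2\<^sub>i\<^sub>+\<^sub>2\<close>. Hence \<open>y\<^sub>2\<^sub>i = C\<^sub>i + I\<^sup>1 y\<^sub>2\<^sub>i\<^sub>+\<^sub>2\<close>, so that \<open>y\<^sub>2\<^sub>i\<close> is the
  \<open>i\<close>-th derivative of \<open>y\<^sub>0\<close>. Conversely, for absolutely continuous \<open>\<phi> = f'\<close> the function
  \<open>D\<^sup>\<beta> f = I\<^sup>\<gamma> \<phi>\<close> is again absolutely continuous, vanishes at \<open>0\<close>, and satisfies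
  \<open>D\<^sup>\<gamma> D\<^sup>\<beta> f = \<phi>\<close>. Uniqueness holds because the difference of two solutions of the system
  satisfies a homogeneous linear Volterra inequality with an integrable kernel.
\<close>

section \<open>Absolutely continuous functions are indefinite integrals\<close>

text \<open>The equations prescribe values at each \<open>t > 0\<close>, whereas the derivative of
  an absolutely continuous function is determined only up to null sets. Every function is therefore
  represented by its initial value and a Borel density on the half-line, and Caputo derivatives are
  computed from that density. The delicate point is the semigroup law: a fractional integral of
  order below 1 of a merely integrable function may diverge at some points, so the law is proved
  pointwise for orders whose sum is at least 1. Complementary orders meet this bound exactly.
  Positivity of the odd orders forces every even order except the last below 1, so order 1 can occur
  only in the last equation. In passing from the equation to the system the odd components are
  forced to be fractional derivatives of \<open>x\<close>; their absolute continuity has to be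
  derived from that of the next integer derivative. Uniqueness goes through an integral inequality
  on bounded intervals, because solutions come with no growth bound at infinity that a Laplace
  transform could use.\<close>

text \<open>
  The variation splits an absolutely continuous function into a difference of two increasing
  absolutely continuous ones. The interval measure of an increasing absolutely continuous
  function has a Radon--Nikodym density.
\<close>

definition division_var :: "(real \<Rightarrow> real) \<Rightarrow> real set set \<Rightarrow> real" where
  "division_var f D = (\<Sum>K\<in>D. \<bar>f (Sup K) - f (Inf K)\<bar>)"

definition partial_divisions :: "real \<Rightarrow> real \<Rightarrow> real set set set" where
  "partial_divisions s t = {D. D division_of \<Union>D \<and> \<Union>D \<subseteq> {s..t}}"

definition variation :: "(real \<Rightarrow> real) \<Rightarrow> real \<Rightarrow> real \<Rightarrow> real" where
  "variation f s t = (SUP D\<in>partial_divisions s t. division_var f D)"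

section \<open>Sums of increments over divisions\<close>

lemma division_of_Icc: "p \<le> q \<Longrightarrow> {{p..q}} division_of {p..q}" for p q :: real
  using division_of_self[of p q] by auto

lemma division_elem_real:
  fixes D :: "real set set"
  assumes "D division_of S" "K \<in> D"
  obtains p q where "p \<le> q" "K = {p..q}" "Inf K = p" "Sup K = q"
proof -
  obtain p q where "K = cbox p q" "K \<noteq> {}" using division_ofD(3,4)[OF assms] by blast
  thus ?thesis using that[of p q] by auto
qed

lemma empty_partial_division: "{} \<in> partial_divisions s t"
  unfolding partial_divisions_def by auto

text \<open>Distinct members of \<open>D\<close> may leave the same trace on \<open>{p..q}\<close>,
  so the sum over \<open>D\<close> could differ from the sum over the set of traces. A shared trace
  has empty interior, hence is empty or a single point, and its term is 0. The case distinction
  discards empty traces, for which \<open>Inf\<close> and \<open>Sup\<close> carry no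
  meaning.\<close>

lemma restrict_division:
  assumes "D division_of \<Union>D" "p \<le> q"
  defines "R \<equiv> (\<lambda>K. K \<inter> {p..q}) ` D - {{}}"
  shows "R \<in> partial_divisions p q"
    and "(\<Sum>K\<in>D. if K \<inter> {p..q} = {} then 0 else \<bar>f (Sup (K \<inter> {p..q})) - f (Inf (K \<inter> {p..q}))\<bar>)
           = division_var f R"
proof -
  have "{{p..q}} division_of {p..q}" by (rule division_of_Icc[OF assms(2)])
  from division_inter[OF assms(1) this]
  have "{k1 \<inter> k2 |k1 k2. k1 \<in> D \<and> k2 \<in> {{p..q}} \<and> k1 \<inter> k2 \<noteq> {}} division_of \<Union> D \<inter> {p..q}" .
  also have "{k1 \<inter> k2 |k1 k2. k1 \<in> D \<and> k2 \<in> {{p..q}} \<and> k1 \<inter> k2 \<noteq> {}} = R"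
    unfolding R_def by auto
  finally have d: "R division_of \<Union> D \<inter> {p..q}" .
  thus "R \<in> partial_divisions p q" unfolding partial_divisions_def using division_ofD(6)[OF d]
    by auto
  let ?d = "\<lambda>L. if L = {} then 0 else \<bar>f (Sup L) - f (Inf L)\<bar>"
  have fin: "finite D" using assms(1) by blast
  have "(\<Sum>K\<in>D. ?d (K \<inter> {p..q})) = sum ?d ((\<lambda>K. K \<inter> {p..q}) ` D)"
  proof (rule sum.reindex_nontrivial[OF fin, symmetric, unfolded o_def])
    fix K L assume KL: "K \<in> D" "L \<in> D" "K \<noteq> L" "K \<inter> {p..q} = L \<inter> {p..q}"
    have "interior K \<inter> interior L = {}" using division_ofD(5)[OF assms(1)] KL by blast
    moreover have "interior (K \<inter> {p..q}) \<subseteq> interior K \<inter> interior L"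
      using KL(4) by (metis Int_lower1 interior_mono le_inf_iff)
    ultimately have i: "interior (K \<inter> {p..q}) = {}" by blast
    show "?d (K \<inter> {p..q}) = 0"
    proof (cases "K \<inter> {p..q} = {}")
      case False
      hence "K \<inter> {p..q} \<in> R" unfolding R_def using KL(1) by auto
      then obtain u v where "u \<le> v" "K \<inter> {p..q} = {u..v}" "Inf (K \<inter> {p..q}) = u"
        "Sup (K \<inter> {p..q}) = v"
        using division_elem_real[OF d] by blast
      thus ?thesis using i by auto
    qed auto
  qed
  also have "\<dots> = sum ?d R" unfolding R_def using fin by (intro sum.mono_neutral_right) auto
  also have "\<dots> = division_var f R" unfolding division_var_def
    by (intro sum.cong) (auto simp: R_def)
  finally show "(\<Sum>K\<in>D. ?d (K \<inter> {p..q})) = division_var f R" .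
qed

text \<open>Cutting at \<open>t\<close> can only increase the sum: a cell that straddles
  \<open>t\<close> obeys the triangle inequality, and every other cell survives whole on one
  side.\<close>

lemma split_division:
  assumes "D \<in> partial_divisions s u" "s \<le> t" "t \<le> u"
  obtains D1 D2 where "D1 \<in> partial_divisions s t" "D2 \<in> partial_divisions t u"
    "division_var f D \<le> division_var f D1 + division_var f D2"
proof -
  have D: "D division_of \<Union>D" "\<Union>D \<subseteq> {s..u}" using assms(1) by (auto simp: partial_divisions_def)
  let ?d = "\<lambda>L. if L = {} then 0 else \<bar>f (Sup L) - f (Inf L)\<bar>"
  have "division_var f D \<le> (\<Sum>K\<in>D. ?d (K \<inter> {s..t}) + ?d (K \<inter> {t..u}))"
    unfolding division_var_def
  proof (rule sum_mono)
    fix K assume K: "K \<in> D"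
    then obtain p q where pq: "p \<le> q" "K = {p..q}" "Inf K = p" "Sup K = q"
      using division_elem_real[OF D(1)] by blast
    have su: "s \<le> p" "q \<le> u" using D(2) K pq
      by (metis Union_upper atLeastatMost_subset_iff order_trans)+
    have 1: "K \<inter> {s..t} = {p..min q t}" "K \<inter> {t..u} = {max p t..q}" using su pq by auto
    consider "t \<le> p" | "q \<le> t" | "p < t" "t < q" by linarith
    thus "\<bar>f (Sup K) - f (Inf K)\<bar> \<le> ?d (K \<inter> {s..t}) + ?d (K \<inter> {t..u})"
      unfolding 1 using pq(1) by cases (auto simp: pq)
  qed
  also have "\<dots> = division_var f ((\<lambda>K. K \<inter> {s..t}) ` D - {{}}) + division_var f ((\<lambda>K. K \<inter> {t..u}) ` D
    - {{}})"
    unfolding sum.distrib restrict_division(2)[OF D(1) assms(2)] restrict_division(2)[OF D(1)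
      assms(3)] ..
  finally show ?thesis using that restrict_division(1)[OF D(1) assms(2)] restrict_division(1)[OF
    D(1) assms(3)] by blast
qed

lemma partial_divisions_mono:
  "s' \<le> s \<Longrightarrow> t \<le> t' \<Longrightarrow> partial_divisions s t \<subseteq> partial_divisions s' t'"
  unfolding partial_divisions_def by fastforce

lemma join_divisions:
  assumes "D1 \<in> partial_divisions s t" "D2 \<in> partial_divisions t u" "s \<le> t" "t \<le> u"
  shows "D1 \<union> D2 \<in> partial_divisions s u"
    "division_var f (D1 \<union> D2) = division_var f D1 + division_var f D2"
proof -
  have D: "D1 division_of \<Union>D1" "\<Union>D1 \<subseteq> {s..t}" "D2 division_of \<Union>D2" "\<Union>D2 \<subseteq> {t..u}"
    using assms by (auto simp: partial_divisions_def)
  have "interior (\<Union>D1) \<inter> interior (\<Union>D2) \<subseteq> interior {s..t} \<inter> interior {t..u}"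
    using interior_mono[OF D(2)] interior_mono[OF D(4)] by blast
  also have "\<dots> = {}" by auto
  finally have "(D1 \<union> D2) division_of (\<Union>D1 \<union> \<Union>D2)"
    by (intro division_disjoint_union D) auto
  moreover have "\<Union>D1 \<union> \<Union>D2 \<subseteq> {s..u}"
  proof -
    have "{s..t} \<subseteq> {s..u}" "{t..u} \<subseteq> {s..u}" using assms by auto
    thus ?thesis using D by blast
  qed
  ultimately show "D1 \<union> D2 \<in> partial_divisions s u" unfolding partial_divisions_def by auto
  have fin: "finite D1" "finite D2" using D by auto
  \<comment> \<open>The union of the two sets counts a common member once, the sum of the two sums
    twice. Such a member can only be the degenerate interval at \<open>t\<close>, whose increment is
    0.\<close>
  have "(\<Sum>K\<in>D1 \<inter> D2. \<bar>f (Sup K) - f (Inf K)\<bar>) = 0"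
  proof (rule sum.neutral, safe)
    fix K assume K: "K \<in> D1" "K \<in> D2"
    then obtain p q where pq: "p \<le> q" "K = {p..q}" "Inf K = p" "Sup K = q"
      using division_elem_real[OF D(1)] by blast
    have "K \<subseteq> {s..t}" "K \<subseteq> {t..u}" using D K by blast+
    hence "p = q" using pq by auto
    thus "\<bar>f (Sup K) - f (Inf K)\<bar> = 0" using pq by simp
  qed
  thus "division_var f (D1 \<union> D2) = division_var f D1 + division_var f D2"
    unfolding division_var_def using sum.union_inter[OF fin, of "\<lambda>K. \<bar>f (Sup K) - f (Inf K)\<bar>"]
      by simp
qed

text \<open>Turns the length in the definition of absolute continuity into a measure, so that
  lengths of different divisions can be compared by inclusion of their unions.\<close>

lemma division_of_total_length:
  fixes D :: "real set set"
  assumes "D division_of \<Union>D"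
  shows "(\<Sum>K\<in>D. Sup K - Inf K) = measure lebesgue (\<Union>D)"
proof -
  have "(\<Sum>K\<in>D. Sup K - Inf K) = sum (measure lebesgue) D"
  proof (rule sum.cong[OF refl])
    fix K assume "K \<in> D"
    then obtain p q where pq: "p \<le> q" "K = {p..q}" "Inf K = p" "Sup K = q"
      using division_elem_real[OF assms] by blast
    thus "Sup K - Inf K = measure lebesgue K" by simp
  qed
  thus ?thesis using content_division[OF assms] by simp
qed

lemma partial_division_length:
  assumes "D \<in> partial_divisions s t" "s \<le> t"
  shows "(\<Sum>K\<in>D. Sup K - Inf K) \<le> t - s"
proof -
  have "(\<Sum>K\<in>D. Sup K - Inf K) = measure lebesgue (\<Union>D)"
    using assms by (intro division_of_total_length) (auto simp: partial_divisions_def)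
  also have "\<dots> \<le> measure lebesgue {s..t}"
    using assms by (intro measure_mono_fmeasurable) (auto simp: partial_divisions_def
      division_of_def
       intro!: sets.finite_Union fmeasurableD)
  finally show ?thesis using assms by simp
qed

section \<open>Variation of an absolutely continuous function\<close>

lemma abs_continuous_onD:
  assumes "abs_continuous_on 0 T f" "\<epsilon> > 0"
  obtains \<delta> where "\<delta> > 0" "\<And>s t D. 0 \<le> s \<Longrightarrow> t \<le> T \<Longrightarrow> D \<in> partial_divisions s t \<Longrightarrow>
    (\<Sum>K\<in>D. Sup K - Inf K) < \<delta> \<Longrightarrow> division_var f D < \<epsilon>"
proof -
  obtain \<delta> where d: "\<delta> > 0" "\<And>\<D>. \<D> division_of \<Union>\<D> \<Longrightarrow> \<Union>\<D> \<subseteq> {0..T} \<Longrightarrow> (\<Sum>K\<in>\<D>. Sup K - Inf K) < \<delta> \<Longrightarrow>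
        (\<Sum>K\<in>\<D>. \<bar>f (Sup K) - f (Inf K)\<bar>) < \<epsilon>"
    using assms unfolding abs_continuous_on_def by meson
  show ?thesis
  proof (rule that[OF d(1)])
    fix s t :: real and D assume *: "0 \<le> s" "t \<le> T" "D \<in> partial_divisions s t"
      "(\<Sum>K\<in>D. Sup K - Inf K) < \<delta>"
    then have "D \<in> partial_divisions 0 T" using partial_divisions_mono by blast
    thus "division_var f D < \<epsilon>" unfolding division_var_def using d(2)[of D] *
      by (auto simp: partial_divisions_def)
  qed
qed

text \<open>Absolute continuity with \<open>\<epsilon> = 1\<close> bounds every sum by 1 on an
  interval shorter than \<open>\<delta>\<close>. Induction splits off pieces of length at most
  \<open>\<delta>/2\<close> from the right end, each adding at most 1.\<close>

lemma bdd_above_variation: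
  assumes "abs_continuous_on 0 T f" "0 \<le> s" "t \<le> T"
  shows "bdd_above (division_var f ` partial_divisions s t)"
proof -
  obtain \<delta> where d: "\<delta> > 0" "\<And>s t D. 0 \<le> s \<Longrightarrow> t \<le> T \<Longrightarrow> D \<in> partial_divisions s t \<Longrightarrow>
    (\<Sum>K\<in>D. Sup K - Inf K) < \<delta> \<Longrightarrow> division_var f D < 1"
    using abs_continuous_onD[OF assms(1), of 1] by auto
  have *: "\<forall>D\<in>partial_divisions s t. division_var f D \<le> real n"
    if "0 \<le> s" "s \<le> t" "t \<le> T" "t - s < real n * (\<delta>/2)" for n s t
    using that
  proof (induction n arbitrary: t)
    case 0 thus ?case by auto
  next
    case (Suc n)
    define r where "r = max s (t - \<delta>/2)"
    have r: "s \<le> r" "r \<le> t" using Suc.prems d(1) by (auto simp: r_def)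
    have short: "\<And>D. D \<in> partial_divisions r t \<Longrightarrow> division_var f D \<le> 1"
    proof -
      fix D assume "D \<in> partial_divisions r t"
      moreover have "t - r < \<delta>" using d(1) by (auto simp: r_def)
      ultimately show "division_var f D \<le> 1"
        using partial_division_length[of D r t] r Suc.prems d(2)[of r t D] by linarith
    qed
    show ?case
    proof
      fix D assume "D \<in> partial_divisions s t"
      then obtain D1 D2 where D12: "D1 \<in> partial_divisions s r" "D2 \<in> partial_divisions r t"
        "division_var f D \<le> division_var f D1 + division_var f D2"
        using split_division r by metis
      show "division_var f D \<le> real (Suc n)"
      \<comment> \<open>The induction hypothesis asks for a strict inequality, which for
        \<open>r = s\<close> and \<open>n = 0\<close> would read \<open>0 < 0\<close>.\<close>
      proof (cases "r = s")
        case True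
        then show ?thesis using short \<open>D \<in> partial_divisions s t\<close> by force
      next
        case False
        hence "r - s < real n * (\<delta>/2)" using Suc.prems(4)
          by (auto simp: r_def field_simps max_def split: if_splits)
        then have "division_var f D1 \<le> real n" using Suc.IH[of r] Suc.prems r D12 by auto
        then show ?thesis using short[OF D12(2)] D12(3) by simp
      qed
    qed
  qed
  show ?thesis
  proof (cases "s \<le> t")
    case True
    obtain n where "t - s < real n * (\<delta>/2)" using d(1) reals_Archimedean3[of "\<delta>/2"]
      by (meson half_gt_zero)
    then show ?thesis using *[of s t n] assms True by (intro bdd_aboveI[of _ "real n"]) auto
  next
    case False
    then have "D \<in> partial_divisions s t \<Longrightarrow> D = {}" for D
      unfolding partial_divisions_def division_of_def by fastforce
    then have "division_var f ` partial_divisions s t \<subseteq> {0}"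
      unfolding division_var_def by (metis (mono_tags, lifting) image_subsetI insertI1 sum.empty)
    then show ?thesis by (rule bdd_above_mono[rotated]) simp
  qed
qed

lemma variation_ge:
  assumes "abs_continuous_on 0 T f" "0 \<le> s" "t \<le> T" "D \<in> partial_divisions s t"
  shows "division_var f D \<le> variation f s t"
  unfolding variation_def using bdd_above_variation[OF assms(1-3)] assms(4)
    by (rule cSUP_upper2) auto

lemma variation_nonneg:
  assumes "abs_continuous_on 0 T f" "0 \<le> s" "t \<le> T"
  shows "0 \<le> variation f s t"
  using variation_ge[OF assms empty_partial_division] by (simp add: division_var_def)

lemma variation_least:
  assumes "\<And>D. D \<in> partial_divisions s t \<Longrightarrow> division_var f D \<le> B"
  shows "variation f s t \<le> B"
  unfolding variation_def using empty_partial_division assms by (intro cSUP_least) auto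

text \<open>Cutting divisions at \<open>t\<close> gives one inequality and joining them the other;
  in the latter the two suprema are taken one after the other.\<close>

lemma variation_split:
  assumes "abs_continuous_on 0 T f" "0 \<le> s" "s \<le> t" "t \<le> u" "u \<le> T"
  shows "variation f s u = variation f s t + variation f t u"
proof (rule antisym)
  show "variation f s u \<le> variation f s t + variation f t u"
  proof (rule variation_least)
    fix D assume "D \<in> partial_divisions s u"
    then obtain D1 D2 where D12: "D1 \<in> partial_divisions s t" "D2 \<in> partial_divisions t u"
        "division_var f D \<le> division_var f D1 + division_var f D2"
      using split_division assms by metis
    thus "division_var f D \<le> variation f s t + variation f t u"
      using variation_ge[OF assms(1) _ _ D12(1)] variation_ge[OF assms(1) _ _ D12(2)] assms by auto
  qed
  have "variation f s t \<le> variation f s u - variation f t u"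
  proof (rule variation_least)
    fix D1 assume D1: "D1 \<in> partial_divisions s t"
    have "variation f t u \<le> variation f s u - division_var f D1"
    proof (rule variation_least)
      fix D2 assume D2: "D2 \<in> partial_divisions t u"
      show "division_var f D2 \<le> variation f s u - division_var f D1"
        using variation_ge[OF assms(1,2,5) join_divisions(1)[OF D1 D2 assms(3,4)]]
          join_divisions(2)[OF D1 D2 assms(3,4), of f] by simp
    qed
    thus "division_var f D1 \<le> variation f s u - variation f t u" by simp
  qed
  thus "variation f s t + variation f t u \<le> variation f s u" by simp
qed

lemma abs_diff_le_variation:
  assumes "abs_continuous_on 0 T f" "0 \<le> s" "s \<le> t" "t \<le> T"
  shows "\<bar>f t - f s\<bar> \<le> variation f s t"
proof -
  have "{{s..t}} division_of {s..t}" by (rule division_of_Icc[OF assms(3)])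
  hence "{{s..t}} \<in> partial_divisions s t" unfolding partial_divisions_def by auto
  from variation_ge[OF assms(1,2,4) this] show ?thesis using assms(3)
    by (simp add: division_var_def)
qed

lemma division_of_refine:
  fixes D :: "real set set"
  assumes D: "D division_of \<Union>D"
    and E: "\<And>K. K \<in> D \<Longrightarrow> E K \<in> partial_divisions (Inf K) (Sup K)"
  obtains F where "F division_of \<Union>F" "\<Union>F \<subseteq> \<Union>D" "division_var f F = (\<Sum>K\<in>D. division_var f (E K))"
proof -
  \<comment> \<open>Degenerate intervals may occur in several \<open>E K\<close>, but contribute nothing.\<close>
  define E' where "E' K = {L \<in> E K. interior L \<noteq> {}}" for K
  have fin: "finite D" using D by auto
  have EK: "E K division_of \<Union>(E K)" "\<Union>(E K) \<subseteq> K" if "K \<in> D" for K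
  proof -
    have "K = {Inf K..Sup K}" using division_elem_real[OF D that] by metis
    thus "E K division_of \<Union>(E K)" "\<Union>(E K) \<subseteq> K" using E[OF that]
      by (auto simp: partial_divisions_def)
  qed
  have EK': "E' K division_of \<Union>(E' K)" if "K \<in> D" for K
    using EK(1)[OF that] by (rule division_of_subset) (auto simp: E'_def)
  have LK: "L \<subseteq> K" "interior L \<noteq> {}" if "K \<in> D" "L \<in> E' K" for L K
    using EK(2)[OF that(1)] that(2) by (auto simp: E'_def)
  have int: "interior L \<inter> interior L' = {}" if "K \<in> D" "K' \<in> D" "L \<in> E' K" "L' \<in> E' K'" "K \<noteq> K'"
    for K K' L L'
    using interior_mono[OF LK(1)[OF that(1,3)]] interior_mono[OF LK(1)[OF that(2,4)]]
      division_ofD(5)[OF D that(1,2,5)] by blast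
  define F where "F = \<Union>(E' ` D)"
  have div: "F division_of \<Union>F"
  proof (rule division_ofI)
    show "finite F" unfolding F_def using fin division_ofD(1)[OF EK'] by auto
    fix K assume "K \<in> F"
    then obtain K' where K': "K' \<in> D" "K \<in> E' K'" by (auto simp: F_def)
    from division_ofD(3,4)[OF EK'[OF K'(1)] K'(2)] show "K \<noteq> {}" "\<exists>a b. K = cbox a b" by auto
    show "K \<subseteq> \<Union>F" using \<open>K \<in> F\<close> by auto
  next
    fix L L' assume "L \<in> F" "L' \<in> F" and ne: "L \<noteq> L'"
    then obtain K K' where K: "K \<in> D" "L \<in> E' K" "K' \<in> D" "L' \<in> E' K'" by (auto simp: F_def)
    show "interior L \<inter> interior L' = {}"
    proof (cases "K = K'")
      case True thus ?thesis using division_ofD(5)[OF EK'[OF K(1)]] K ne by auto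
    next
      case False thus ?thesis using int K by blast
    qed
  qed auto
  have "division_var f F = (\<Sum>K\<in>D. division_var f (E' K))"
    unfolding division_var_def F_def
  proof (rule sum.UNION_disjoint[OF fin])
    show "\<forall>i\<in>D. finite (E' i)" using EK' by blast
    show "\<forall>i\<in>D. \<forall>j\<in>D. i \<noteq> j \<longrightarrow> E' i \<inter> E' j = {}"
    proof (intro ballI impI)
      fix K K' assume K: "K \<in> D" "K' \<in> D" "K \<noteq> K'"
      { fix L assume "L \<in> E' K" "L \<in> E' K'"
        hence False using int[OF K(1,2) _ _ K(3), of L L] LK(2)[OF K(1)] by blast }
      thus "E' K \<inter> E' K' = {}" by blast
    qed
  qed
  also have "\<dots> = (\<Sum>K\<in>D. division_var f (E K))"
  proof (rule sum.cong[OF refl])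
    fix K assume K: "K \<in> D"
    show "division_var f (E' K) = division_var f (E K)" unfolding division_var_def
    proof (rule sum.mono_neutral_left)
      show "finite (E K)" using EK[OF K] by auto
      show "E' K \<subseteq> E K" by (auto simp: E'_def)
      show "\<forall>i\<in>E K - E' K. \<bar>f (Sup i) - f (Inf i)\<bar> = 0"
      proof
        fix L assume L: "L \<in> E K - E' K"
        then obtain p q where pq: "p \<le> q" "L = {p..q}" "Inf L = p" "Sup L = q"
          using division_elem_real[OF EK(1)[OF K], of L] by blast
        thus "\<bar>f (Sup L) - f (Inf L)\<bar> = 0" using L by (auto simp: E'_def)
      qed
    qed
  qed
  finally have "division_var f F = (\<Sum>K\<in>D. division_var f (E K))" .
  moreover have "\<Union>F \<subseteq> \<Union>D" using LK(1) by (fastforce simp: F_def)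
  ultimately show ?thesis using that div by blast
qed

text \<open>The variation over each cell of \<open>D\<close> is nearly attained by some division of
  that cell. Glued together, these form one division of total length below \<open>\<delta>\<close>,
  to which the absolute continuity of \<open>f\<close> itself applies. The
  \<open>\<epsilon>/3\<close> leaves another third for the approximation errors and the rest for
  strictness.\<close>

lemma abs_continuous_on_variation:
  assumes ac: "abs_continuous_on 0 T f"
  shows "abs_continuous_on 0 T (variation f 0)"
  unfolding abs_continuous_on_def
proof (intro allI impI)
  fix \<epsilon> :: real assume e: "\<epsilon> > 0"
  obtain \<delta> where d: "\<delta> > 0" "\<And>s t D. 0 \<le> s \<Longrightarrow> t \<le> T \<Longrightarrow> D \<in> partial_divisions s t \<Longrightarrow>
    (\<Sum>K\<in>D. Sup K - Inf K) < \<delta> \<Longrightarrow> division_var f D < \<epsilon>/3"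
    using abs_continuous_onD[OF ac, of "\<epsilon>/3"] e by auto
  show "\<exists>\<delta>>0. \<forall>\<D>. \<D> division_of \<Union> \<D> \<and> \<Union> \<D> \<subseteq> {0..T} \<and> (\<Sum>K\<in>\<D>. Sup K - Inf K) < \<delta> \<longrightarrow>
     (\<Sum>K\<in>\<D>. \<bar>variation f 0 (Sup K) - variation f 0 (Inf K)\<bar>) < \<epsilon>"
  proof (intro exI conjI allI impI, rule d(1), elim conjE)
    fix D assume D: "D division_of \<Union> D" "\<Union> D \<subseteq> {0..T}" "(\<Sum>K\<in>D. Sup K - Inf K) < \<delta>"
    \<comment> \<open>The error allowed per cell; \<open>card D\<close> of them add up to at most
      \<open>\<epsilon>/3\<close>, and the summand 1 keeps the denominator positive for empty
      \<open>D\<close>.\<close>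
    define \<eta> where "\<eta> = \<epsilon> / (3 * (real (card D) + 1))"
    have eta: "\<eta> > 0" using e by (simp add: \<eta>_def)
    have fin: "finite D" using D by auto
    have KT: "0 \<le> Inf K" "Inf K \<le> Sup K" "Sup K \<le> T" "K = {Inf K..Sup K}" if K: "K \<in> D" for K
    proof -
      obtain p q where pq: "p \<le> q" "K = {p..q}" "Inf K = p" "Sup K = q"
          using division_elem_real[OF D(1) K] by blast
      have "{p..q} \<subseteq> {0..T}" using K D(2) pq by blast
      thus "0 \<le> Inf K" "Inf K \<le> Sup K" "Sup K \<le> T" "K = {Inf K..Sup K}" using pq by auto
    qed
    have "\<exists>E. E \<in> partial_divisions (Inf K) (Sup K) \<and> variation f (Inf K) (Sup K) - \<eta>
      < division_var f E" if "K \<in> D" for K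
    proof -
      have "variation f (Inf K) (Sup K) - \<eta> < variation f (Inf K) (Sup K)" using eta by simp
      then show ?thesis unfolding variation_def using empty_partial_division
        less_cSUP_iff[OF _ bdd_above_variation[OF ac KT(1,3)[OF that]]] by blast
    qed
    then obtain E where E: "\<And>K. K \<in> D \<Longrightarrow> E K \<in> partial_divisions (Inf K) (Sup K)"
      "\<And>K. K \<in> D \<Longrightarrow> variation f (Inf K) (Sup K) - \<eta> < division_var f (E K)" by metis
    obtain F where F: "F division_of \<Union>F" "\<Union>F \<subseteq> \<Union>D" "division_var f F = (\<Sum>K\<in>D. division_var f (E K))"
      using division_of_refine[OF D(1) E(1), of f] by blast
    have "(\<Sum>K\<in>F. Sup K - Inf K) \<le> (\<Sum>K\<in>D. Sup K - Inf K)"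
      unfolding division_of_total_length[OF D(1)] division_of_total_length[OF F(1)]
    proof (rule measure_mono_fmeasurable[OF F(2)])
      show "\<Union>F \<in> sets lebesgue" using F(1) by (auto simp: division_of_def intro!: sets.finite_Union)
      show "\<Union>D \<in> lmeasurable" using lmeasurable_division[OF D(1)] .
    qed
    hence "division_var f F < \<epsilon>/3" using d(2)[of 0 T F] F D by (auto simp: partial_divisions_def)
    have "(\<Sum>K\<in>D. \<bar>variation f 0 (Sup K) - variation f 0 (Inf K)\<bar>)
      = (\<Sum>K\<in>D. variation f (Inf K) (Sup K))"
    proof (rule sum.cong[OF refl])
      fix K assume K: "K \<in> D"
      show "\<bar>variation f 0 (Sup K) - variation f 0 (Inf K)\<bar> = variation f (Inf K) (Sup K)"
        using variation_split[OF ac order_refl KT(1-3)[OF K]] variation_nonneg[OF ac KT(1,3)[OF K]]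
          by simp
    qed
    also have "\<dots> \<le> (\<Sum>K\<in>D. division_var f (E K) + \<eta>)"
      using E(2) by (intro sum_mono) (simp add: algebra_simps less_imp_le)
    also have "\<dots> = division_var f F + card D * \<eta>" by (simp add: sum.distrib F)
    also have "card D * \<eta> \<le> \<epsilon>/3" using e by (simp add: \<eta>_def field_simps)
    finally show "(\<Sum>K\<in>D. \<bar>variation f 0 (Sup K) - variation f 0 (Inf K)\<bar>) < \<epsilon>"
      using \<open>division_var f F < \<epsilon>/3\<close> e by simp
  qed
qed

lemma abs_continuous_on_diff:
  assumes "abs_continuous_on a b f" "abs_continuous_on a b g"
  shows "abs_continuous_on a b (\<lambda>x. f x - g x)"
  unfolding abs_continuous_on_def
proof (intro allI impI)
  fix \<epsilon> :: real assume e: "\<epsilon> > 0"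
  obtain d1 where d1: "d1 > 0" "\<And>\<D>. \<D> division_of \<Union>\<D> \<Longrightarrow> \<Union>\<D> \<subseteq> {a..b} \<Longrightarrow> (\<Sum>K\<in>\<D>. Sup K - Inf K) < d1 \<Longrightarrow>
        (\<Sum>K\<in>\<D>. \<bar>f (Sup K) - f (Inf K)\<bar>) < \<epsilon>/2"
    using assms(1) e unfolding abs_continuous_on_def by (meson half_gt_zero)
  obtain d2 where d2: "d2 > 0" "\<And>\<D>. \<D> division_of \<Union>\<D> \<Longrightarrow> \<Union>\<D> \<subseteq> {a..b} \<Longrightarrow> (\<Sum>K\<in>\<D>. Sup K - Inf K) < d2 \<Longrightarrow>
        (\<Sum>K\<in>\<D>. \<bar>g (Sup K) - g (Inf K)\<bar>) < \<epsilon>/2"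
    using assms(2) e unfolding abs_continuous_on_def by (meson half_gt_zero)
  show "\<exists>\<delta>>0. \<forall>\<D>. \<D> division_of \<Union> \<D> \<and> \<Union> \<D> \<subseteq> {a..b} \<and> (\<Sum>K\<in>\<D>. Sup K - Inf K) < \<delta> \<longrightarrow>
     (\<Sum>K\<in>\<D>. \<bar>f (Sup K) - g (Sup K) - (f (Inf K) - g (Inf K))\<bar>) < \<epsilon>"
  proof (intro exI[of _ "min d1 d2"] conjI allI impI)
    show "min d1 d2 > 0" using d1 d2 by auto
    fix \<D> assume *: "\<D> division_of \<Union> \<D> \<and> \<Union> \<D> \<subseteq> {a..b} \<and> (\<Sum>K\<in>\<D>. Sup K - Inf K) < min d1 d2"
    have "(\<Sum>K\<in>\<D>. \<bar>f (Sup K) - g (Sup K) - (f (Inf K) - g (Inf K))\<bar>)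
        \<le> (\<Sum>K\<in>\<D>. \<bar>f (Sup K) - f (Inf K)\<bar> + \<bar>g (Sup K) - g (Inf K)\<bar>)"
      by (intro sum_mono) linarith
    also have "\<dots> < \<epsilon>" unfolding sum.distrib using d1(2)[of \<D>] d2(2)[of \<D>] * by simp
    finally show "(\<Sum>K\<in>\<D>. \<bar>f (Sup K) - g (Sup K) - (f (Inf K) - g (Inf K))\<bar>) < \<epsilon>" .
  qed
qed

section \<open>Continuity and densities of absolutely continuous functions\<close>

lemma abs_continuous_on_imp_continuous_on:
  assumes "\<And>T. T > 0 \<Longrightarrow> abs_continuous_on 0 T f"
  shows "continuous_on {0..} f"
  unfolding continuous_on_iff
proof (intro ballI allI impI)
  fix x e :: real assume x: "x \<in> {0..}" and e: "e > 0"
  have "abs_continuous_on 0 (x + 1) f" using x assms by auto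
  from abs_continuous_onD[OF this e] obtain \<delta> where d: "\<delta> > 0" "\<And>s t D. 0 \<le> s \<Longrightarrow> t \<le> x + 1
    \<Longrightarrow> D \<in> partial_divisions s t \<Longrightarrow>
    (\<Sum>K\<in>D. Sup K - Inf K) < \<delta> \<Longrightarrow> division_var f D < e" by blast
  have *: "\<bar>f t - f s\<bar> < e" if "0 \<le> s" "s \<le> t" "t \<le> x + 1" "t - s < \<delta>" for s t
  proof -
    have "{{s..t}} division_of {s..t}" by (rule division_of_Icc[OF that(2)])
    hence "{{s..t}} \<in> partial_divisions s t" unfolding partial_divisions_def by auto
    from d(2)[OF that(1,3) this] show ?thesis using that by (simp add: division_var_def)
  qed
  show "\<exists>d>0. \<forall>x'\<in>{0..}. dist x' x < d \<longrightarrow> dist (f x') (f x) < e"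
  proof (intro exI[of _ "min \<delta> 1"] conjI ballI impI)
    show "0 < min \<delta> 1" using d(1) by auto
    fix y assume y: "y \<in> {0..}" "dist y x < min \<delta> 1"
    show "dist (f y) (f x) < e"
      using *[of x y] *[of y x] x y by (cases "x \<le> y") (auto simp: dist_real_def abs_minus_commute)
  qed
qed

text \<open>The Stieltjes measure of \<open>F\<close> does not charge Lebesgue null sets: cover such
  a set by nonoverlapping intervals of total length below \<open>\<delta>\<close>; their Stieltjes
  measure is at most a sum of increments of \<open>F\<close>, which is below \<open>e\<close>.
  Radon-Nikodym then yields the density.\<close>

lemma mono_abs_continuous_density:
  fixes F :: "real \<Rightarrow> real"
  assumes mono: "\<And>s t. 0 \<le> s \<Longrightarrow> s \<le> t \<Longrightarrow> F s \<le> F t"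
    and ac: "\<And>T. T > 0 \<Longrightarrow> abs_continuous_on 0 T F"
  obtains g where "g \<in> borel_measurable borel" "\<And>t. set_integrable lborel {0..t} g"
    "\<And>t. 0 \<le> t \<Longrightarrow> F t = F 0 + (LINT \<tau>:{0..t}|lborel. g \<tau>)"
proof -
  \<comment> \<open>An interval measure needs a monotone continuous function on the whole line. The
    constant extension puts no mass on the negative half-line.\<close>
  define G where "G x = F (max 0 x)" for x
  have G_mono: "G x \<le> G y" if "x \<le> y" for x y unfolding G_def using that by (intro mono) auto
  have G_cont: "continuous_on UNIV G" unfolding G_def
    by (rule continuous_on_compose2[OF abs_continuous_on_imp_continuous_on[OF ac]])
      (auto intro!: continuous_intros)
  define M where "M = interval_measure G"
  have M_Icc: "emeasure M {a..b} = ennreal (G b - G a)" if "a \<le> b" for a b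
    unfolding M_def by (rule emeasure_interval_measure_Icc[OF that G_mono G_cont])
  have sets_M [simp]: "sets M = sets borel" unfolding M_def by simp
  have small: "emeasure M (N \<inter> {0..T}) \<le> ennreal e"
    if N: "N \<in> null_sets lborel" and T: "T > 0" and e: "e > 0" for N T e
  proof -
    obtain \<delta> where d: "\<delta> > 0" "\<And>s t D. 0 \<le> s \<Longrightarrow> t \<le> T \<Longrightarrow> D \<in> partial_divisions s t \<Longrightarrow>
      (\<Sum>K\<in>D. Sup K - Inf K) < \<delta> \<Longrightarrow> division_var F D < e"
      using abs_continuous_onD[OF ac[OF T] e] by blast
    have "N \<inter> {0..T} \<in> null_sets lborel" by (rule null_set_Int2[OF N]) auto
    hence null: "N \<inter> {0..T} \<in> null_sets lebesgue" by (rule null_sets_completionI)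
    hence lm: "N \<inter> {0..T} \<in> lmeasurable" using fmeasurable_def
      by (auto simp: null_sets_def intro: fmeasurableI)
    have z: "measure lebesgue (N \<inter> {0..T}) = 0" using null by (auto simp: null_sets_def measure_def)
    obtain D where D: "countable D" "\<And>K. K \<in> D \<Longrightarrow> K \<subseteq> cbox 0 T \<and> K \<noteq> {} \<and> (\<exists>c d. K = cbox c d)"
        "pairwise (\<lambda>A B. interior A \<inter> interior B = {}) D" 
        "N \<inter> {0..T} \<subseteq> \<Union>D" "\<Union>D \<in> lmeasurable"
          "measure lebesgue (\<Union>D) \<le> measure lebesgue (N \<inter> {0..T}) + \<delta>/2"
      using measurable_outer_intervals_bounded[OF lm, of 0 T "\<delta>/2"] d(1)
        by (metis Int_lower2 box_real(2) half_gt_zero)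
    have fin: "emeasure M (\<Union>D') \<le> e" if D': "finite D'" "D' \<subseteq> D" for D'
    proof -
      have div: "D' division_of \<Union>D'"
      proof (rule division_ofI[OF D'(1)])
        fix K1 K2 assume "K1 \<in> D'" "K2 \<in> D'" "K1 \<noteq> K2"
        thus "interior K1 \<inter> interior K2 = {}" using D(3) D'(2) unfolding pairwise_def by blast
      qed (use D(2) D'(2) in blast)+
      have pd: "D' \<in> partial_divisions 0 T" unfolding partial_divisions_def using div D(2) D'(2)
        by auto
      have "(\<Sum>K\<in>D'. Sup K - Inf K) = measure lebesgue (\<Union>D')"
        by (rule division_of_total_length[OF div])
      also have "\<dots> \<le> measure lebesgue (\<Union>D)"
        using lmeasurable_division[OF div] D'(2) by (intro measure_mono_fmeasurable D) auto
      also have "\<dots> < \<delta>" using D(6) d(1) z by simp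
      finally have var: "division_var F D' < e" using d(2)[OF _ _ pd] by simp
      have elem: "\<exists>p q. 0 \<le> p \<and> p \<le> q \<and> K = {p..q} \<and> Inf K = p \<and> Sup K = q" if K: "K \<in> D'" for K
      proof -
        obtain p q where pq: "p \<le> q" "K = {p..q}" "Inf K = p" "Sup K = q"
          using division_elem_real[OF div K] by blast
        moreover have "{p..q} \<subseteq> cbox 0 T" using D(2)[of K] D'(2) K pq by blast
        hence "0 \<le> p" using pq by auto
        ultimately show ?thesis by blast
      qed
      have "emeasure M (\<Union>D') \<le> (\<Sum>K\<in>D'. emeasure M K)"
      proof -
        have "K \<in> sets M" if K: "K \<in> D'" for K
        proof -
          obtain p q where "K = {p..q}" using elem[OF K] by blast
          thus ?thesis by simp
        qed
        thus ?thesis using emeasure_subadditive_finite[of D' "\<lambda>K. K" M] D'(1) by auto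
      qed
      also have "\<dots> = (\<Sum>K\<in>D'. ennreal \<bar>F (Sup K) - F (Inf K)\<bar>)"
      proof (rule sum.cong[OF refl])
        fix K assume "K \<in> D'"
        then obtain p q where pq: "0 \<le> p" "p \<le> q" "K = {p..q}" "Inf K = p" "Sup K = q" using elem
          by blast
        show "emeasure M K = ennreal \<bar>F (Sup K) - F (Inf K)\<bar>"
          using M_Icc[of p q] mono[of p q] pq by (simp add: G_def)
      qed
      also have "\<dots> = ennreal (division_var F D')" unfolding division_var_def
        by (rule sum_ennreal) auto
      also have "\<dots> \<le> e" using var by (simp add: ennreal_leI)
      finally show ?thesis .
    qed
    show ?thesis
    proof (cases "D = {}")
      case True
      then show ?thesis using D(4) by auto
    next
      case False
      \<comment> \<open>The cover is countable, but absolute continuity speaks of finite divisions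
        only. The bound therefore passes from finite unions to the whole by continuity of the
        measure from below.\<close>
      let ?A = "\<lambda>n. \<Union>(from_nat_into D ` {..<n})"
      have sub: "from_nat_into D ` {..<n} \<subseteq> D" for n using from_nat_into[OF False] by auto
      have U: "\<Union>D = (\<Union>n. ?A n)"
      proof -
        have "\<Union>D = \<Union>(range (from_nat_into D))" using range_from_nat_into[OF False D(1)] by simp
        also have "\<dots> = (\<Union>n. ?A n)" by blast
        finally show ?thesis .
      qed
      have meas: "K \<in> sets M" if "K \<in> D" for K using D(2)[OF that] by auto
      have "emeasure M (N \<inter> {0..T}) \<le> emeasure M (\<Union>n. ?A n)"
        unfolding U[symmetric] using D(4) meas D(1)
          by (intro emeasure_mono sets.countable_Union) auto
      also have "\<dots> = (SUP n. emeasure M (?A n))"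
      proof (rule SUP_emeasure_incseq[symmetric])
        show "range ?A \<subseteq> sets M" using meas sub by (auto intro!: sets.finite_UN)
        show "incseq ?A" unfolding incseq_def by (auto intro: less_le_trans)
      qed
      also have "\<dots> \<le> ennreal e" by (rule SUP_least) (intro fin sub, auto)
      finally show ?thesis .
    qed
  qed
  have "absolutely_continuous lborel M" unfolding absolutely_continuous_def
  proof
    fix N assume N: "N \<in> null_sets (lborel :: real measure)"
    have NT: "N \<inter> {0..real n + 1} \<in> null_sets M" for n
    proof -
      have "N \<in> sets borel" using N by auto
      moreover have "emeasure M (N \<inter> {0..real n + 1}) \<le> 0"
        by (rule ennreal_le_epsilon) (use small[OF N, of "real n + 1"] in auto)
      ultimately show ?thesis by auto
    qed
    have neg: "{- real n..0} \<in> null_sets M" for n using M_Icc[of "- real n" 0]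
      by (auto simp: G_def null_sets_def)
    have "(\<Union>n. N \<inter> {0..real n + 1}) \<union> (\<Union>n. {- real n..0}) \<in> null_sets M"
      using NT neg by (intro null_sets.Un null_sets_UN) auto
    moreover have "N \<subseteq> (\<Union>n. N \<inter> {0..real n + 1}) \<union> (\<Union>n. {- real n..0})"
    proof
      fix x assume x: "x \<in> N"
      obtain n where "\<bar>x\<bar> \<le> real n" using real_arch_simple by blast
      thus "x \<in> (\<Union>n. N \<inter> {0..real n + 1}) \<union> (\<Union>n. {- real n..0})"
        using x by (cases "x \<ge> 0") (auto intro!: exI[of _ n])
    qed
    ultimately show "N \<in> null_sets M" using N
      by (metis null_sets_subset null_setsD2 sets_M sets_lborel)
  qed
  then obtain h where h: "h \<in> borel_measurable lborel" "density lborel h = M"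
    using sigma_finite_measure.Radon_Nikodym[OF sigma_finite_lborel, of M] by auto
  have [measurable]: "h \<in> borel_measurable borel" using h(1) by simp
  have hI: "(\<integral>\<^sup>+ x. h x * indicator {0..t} x \<partial>lborel) = ennreal (F t - F 0)" if "0 \<le> t" for t
  proof -
    have "(\<integral>\<^sup>+ x. h x * indicator {0..t} x \<partial>lborel) = emeasure (density lborel h) {0..t}"
      by (simp add: emeasure_density)
    thus ?thesis using M_Icc[OF that] h(2) that by (simp add: G_def)
  qed
  \<comment> \<open>The density \<open>h\<close> may take the value \<open>\<infinity>\<close>, but
    on each \<open>{0..t}\<close> only on a null set, since its integral there is the finite
    increment of \<open>F\<close>.\<close>
  define g where "g x = enn2real (h x)" for x
  have [measurable]: "g \<in> borel_measurable borel" unfolding g_def by measurable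
  have gI: "(\<integral>\<^sup>+ x. ennreal (indicator {0..t} x * g x) \<partial>lborel) = ennreal (F t - F 0)" if "0 \<le> t"
    for t
  proof -
    have "AE x in lborel. h x * indicator {0..t} x \<noteq> \<infinity>"
      using hI[OF that] by (intro nn_integral_noteq_infinite) auto
    hence "(\<integral>\<^sup>+ x. ennreal (indicator {0..t} x * g x) \<partial>lborel)
      = (\<integral>\<^sup>+ x. h x * indicator {0..t} x \<partial>lborel)"
      by (intro nn_integral_cong_AE) (auto simp: g_def indicator_def less_top[symmetric] elim!:
        eventually_mono)
    thus ?thesis using hI[OF that] by simp
  qed
  have int: "set_integrable lborel {0..t} g" for t
  proof (cases "0 \<le> t")
    case True
    show ?thesis unfolding set_integrable_def using gI[OF True]
      by (intro integrableI_nonneg) (auto simp: g_def)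
  qed (auto simp: set_integrable_def)
  show ?thesis
  proof (rule that[OF _ int])
    fix t :: real assume t: "0 \<le> t"
    have "(LINT \<tau>:{0..t}|lborel. g \<tau>) = enn2real (\<integral>\<^sup>+ x. ennreal (indicator {0..t} x * g x)
      \<partial>lborel)"
      unfolding set_lebesgue_integral_def by (subst integral_eq_nn_integral) (auto simp: g_def)
    thus "F t = F 0 + (LINT \<tau>:{0..t}|lborel. g \<tau>)" using gI[OF t] mono[of 0 t] t by simp
  qed measurable
qed

theorem abs_continuous_density:
  fixes f :: "real \<Rightarrow> real"
  assumes ac: "\<And>T. T > 0 \<Longrightarrow> abs_continuous_on 0 T f"
  obtains g where "g \<in> borel_measurable borel" "\<And>t. set_integrable lborel {0..t} g"
    "\<And>t. 0 \<le> t \<Longrightarrow> f t = f 0 + (LINT \<tau>:{0..t}|lborel. g \<tau>)"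
proof -
  let ?V = "variation f 0"
  have V: "\<bar>f t - f s\<bar> \<le> ?V t - ?V s" if "0 \<le> s" "s \<le> t" for s t
  proof -
    have ac': "abs_continuous_on 0 (t + 1) f" using ac that by auto
    show ?thesis using abs_diff_le_variation[OF ac' that] variation_split[OF ac' order_refl that]
      by simp
  qed
  have acV: "T > 0 \<Longrightarrow> abs_continuous_on 0 T ?V" for T using abs_continuous_on_variation[OF ac]
    by blast
  have "\<And>s t. 0 \<le> s \<Longrightarrow> s \<le> t \<Longrightarrow> ?V s \<le> ?V t" using V by force
  from mono_abs_continuous_density[OF this acV] obtain g where g: "g \<in> borel_measurable borel"
    "\<And>t. set_integrable lborel {0..t} g" "\<And>t. 0 \<le> t \<Longrightarrow> ?V t = ?V 0 + (LINT \<tau>:{0..t}|lborel. g \<tau>)"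
      by blast
  have "?V s - f s \<le> ?V t - f t" if "0 \<le> s" "s \<le> t" for s t using V[OF that] by linarith
  from mono_abs_continuous_density[OF this abs_continuous_on_diff[OF acV ac]] obtain h where h:
    "h \<in> borel_measurable borel"
    "\<And>t. set_integrable lborel {0..t} h" "\<And>t. 0 \<le> t
      \<Longrightarrow> ?V t - f t = ?V 0 - f 0 + (LINT \<tau>:{0..t}|lborel. h \<tau>)" by blast
  show ?thesis
  proof (rule that[of "\<lambda>x. g x - h x"])
    show "(\<lambda>x. g x - h x) \<in> borel_measurable borel" using g h by measurable
    show "set_integrable lborel {0..t} (\<lambda>x. g x - h x)" for t using g(2) h(2)
      by (rule set_integral_diff)
    show "f t = f 0 + (LINT \<tau>:{0..t}|lborel. g \<tau> - h \<tau>)" if "0 \<le> t" for t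
      using g(3)[OF that] h(3)[OF that] by (simp add: set_integral_diff[OF g(2) h(2)])
  qed
qed

section \<open>Riemann--Liouville integrals\<close>

text \<open>Extended by 0 to \<open>s \<le> 0\<close>, so that the fractional integral of a function
  vanishing on negative arguments is a convolution over the whole line and Fubini meets no moving
  limits.\<close>

definition rl_kernel :: "real \<Rightarrow> real \<Rightarrow> real" where
  "rl_kernel a s = (if s > 0 then s powr (a - 1) / Gamma a else 0)"

definition rl_integral :: "real \<Rightarrow> (real \<Rightarrow> real) \<Rightarrow> real \<Rightarrow> real" where
  "rl_integral a f t = (LINT \<tau>|lborel. rl_kernel a (t - \<tau>) * f \<tau>)"

section \<open>Convolution of kernels and the semigroup law\<close>

lemma rl_kernel_measurable [measurable]: "rl_kernel a \<in> borel_measurable borel"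
  unfolding rl_kernel_def by measurable

lemma rl_kernel_nonneg: "a > 0 \<Longrightarrow> rl_kernel a s \<ge> 0"
  unfolding rl_kernel_def by (simp add: Gamma_real_nonneg)

text \<open>The substitution \<open>s = \<tau> + d * u\<close> with \<open>d = t - \<tau>\<close>
  turns the convolution into a Beta integral. Working with nonnegative extended integrals yields
  value and integrability together.\<close>

lemma nn_integral_rl_kernel:
  assumes a: "a > 0" and b: "b > 0"
  shows "(\<integral>\<^sup>+ s. ennreal (rl_kernel a (t - s)) * ennreal (rl_kernel b (s - \<tau>)) \<partial>lborel)
           = ennreal (rl_kernel (a + b) (t - \<tau>))"
proof (cases "t > \<tau>")
  case False
  hence "ennreal (rl_kernel a (t - s)) * ennreal (rl_kernel b (s - \<tau>)) = 0" for s
    by (auto simp: rl_kernel_def)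
  hence "(\<integral>\<^sup>+ s. ennreal (rl_kernel a (t - s)) * ennreal (rl_kernel b (s - \<tau>)) \<partial>lborel) = 0"
    by (simp only: nn_integral_const) simp
  thus ?thesis using False by (simp add: rl_kernel_def)
next
  case True
  define d where "d = t - \<tau>"
  have d: "d > 0" using True by (simp add: d_def)
  let ?c = "d powr (a - 1) * d powr (b - 1) / (Gamma a * Gamma b)"
  have c: "?c \<ge> 0" using a b
    by (intro divide_nonneg_nonneg mult_nonneg_nonneg) (auto simp: Gamma_real_nonneg)
  have eq: "ennreal (rl_kernel a (t - (\<tau> + d * u))) * ennreal (rl_kernel b (\<tau> + d * u - \<tau>))
      = ennreal ?c * ennreal (indicator {0..1} u * (u powr (b - 1) * (1 - u) powr (a - 1)))" for u
  proof -
    have 1: "t - (\<tau> + d * u) = d * (1 - u)" by (simp add: d_def algebra_simps)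
    have 2: "0 < d * (1 - u) \<longleftrightarrow> u < 1" "0 < d * u \<longleftrightarrow> 0 < u" using d by (auto simp: zero_less_mult_iff)
    consider "0 < u" "u < 1" | "u \<le> 0" | "u \<ge> 1" by linarith
    thus ?thesis
    proof cases
      case 1
      have "rl_kernel a (d * (1 - u)) * rl_kernel b (d * u)
        = ?c * (u powr (b - 1) * (1 - u) powr (a - 1))"
        using 1 d by (simp add: rl_kernel_def 2 powr_mult)
      thus ?thesis using 1 c rl_kernel_nonneg[OF a] unfolding \<open>t - (\<tau> + d * u) = d * (1 - u)\<close>
        by (simp add: ennreal_mult''[symmetric] ennreal_mult'[symmetric])
    next
      case neg: 2
      have "rl_kernel b (d * u) = 0" using neg 2 by (simp add: rl_kernel_def)
      \<comment> \<open>At \<open>u = 0\<close> the right side vanishes by the convention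
        \<open>0 powr p = 0\<close> for every \<open>p\<close>; the same convention serves
        \<open>u = 1\<close> below.\<close>
      thus ?thesis using neg by (cases "u = 0") auto
    next
      case 3
      have "rl_kernel a (d * (1 - u)) = 0" using 3 2 by (simp add: rl_kernel_def)
      thus ?thesis using 3 1 by (cases "u = 1") auto
    qed
  qed
  have "(\<integral>\<^sup>+ s. ennreal (rl_kernel a (t - s)) * ennreal (rl_kernel b (s - \<tau>)) \<partial>lborel)
      = ennreal d * (\<integral>\<^sup>+ u. ennreal (rl_kernel a (t - (\<tau> + d * u))) * ennreal (rl_kernel b
        (\<tau> + d * u - \<tau>)) \<partial>lborel)"
    using d by (subst nn_integral_real_affine[where c=d and t=\<tau>]) auto
  also have "\<dots> = ennreal d * (ennreal ?c * (\<integral>\<^sup>+ u. ennreal (indicator {0..1} u * (u powr (b - 1) *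
    (1 - u) powr (a - 1))) \<partial>lborel))"
    unfolding eq by (subst nn_integral_cmult) auto
  also have "(\<integral>\<^sup>+ u. ennreal (indicator {0..1} u * (u powr (b - 1) * (1 - u) powr (a - 1))) \<partial>lborel)
    = ennreal (Beta b a)"
    by (rule nn_integral_has_integral_lebesgue[OF _ has_integral_Beta_real[OF b a]]) auto
  also have "ennreal d * (ennreal ?c * ennreal (Beta b a)) = ennreal (d * ?c * Beta b a)"
  proof -
    have B: "Beta b a \<ge> 0" using a b by (simp add: Beta_def Gamma_real_nonneg)
    show ?thesis using ennreal_mult[OF c B] ennreal_mult[of d
      "?c * Beta b a"] mult_nonneg_nonneg[OF c B] d
      by (simp only: less_imp_le mult.assoc)
  qed
  also have "d * ?c * Beta b a = rl_kernel (a + b) (t - \<tau>)"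
  proof -
    have "d * d powr (a - 1) * d powr (b - 1) = d powr (a + b - 1)"
      using d by (simp add: powr_add[symmetric] powr_mult_base algebra_simps)
    moreover have "Gamma a \<noteq> 0" "Gamma b \<noteq> 0" using Gamma_real_pos[OF a] Gamma_real_pos[OF b]
      by linarith+
    ultimately show ?thesis using True d
      by (simp add: rl_kernel_def d_def[symmetric] Beta_def add.commute field_simps)
  qed
  finally show ?thesis .
qed

lemma integral_rl_kernel:
  assumes "a > 0" "b > 0"
  shows "(LINT s|lborel. rl_kernel a (t - s) * rl_kernel b (s - \<tau>)) = rl_kernel (a + b) (t - \<tau>)"
    "integrable lborel (\<lambda>s. rl_kernel a (t - s) * rl_kernel b (s - \<tau>))"
proof -
  have nn: "(\<integral>\<^sup>+ s. ennreal (rl_kernel a (t - s) * rl_kernel b (s - \<tau>)) \<partial>lborel)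
    = ennreal (rl_kernel (a + b) (t - \<tau>))"
    using nn_integral_rl_kernel[OF assms] rl_kernel_nonneg assms by (simp add: ennreal_mult)
  have pos: "rl_kernel a (t - s) * rl_kernel b (s - \<tau>) \<ge> 0" for s using rl_kernel_nonneg assms
    by simp
  show "integrable lborel (\<lambda>s. rl_kernel a (t - s) * rl_kernel b (s - \<tau>))"
    using nn pos by (intro integrableI_nonneg) auto
  show "(LINT s|lborel. rl_kernel a (t - s) * rl_kernel b (s - \<tau>)) = rl_kernel (a + b) (t - \<tau>)"
    using nn pos rl_kernel_nonneg[of "a + b"] assms by (subst integral_eq_nn_integral) auto
qed

text \<open>By Tonelli the absolute double integral reduces to the single integral in
  \<open>int\<close>, because the two kernels convolve to one; Fubini then exchanges the order. The
  integral defining \<open>rl_integral b f s\<close> may still diverge for exceptional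
  \<open>s < t\<close>, but these form a null set.\<close>

lemma rl_integral_rl_integral:
  assumes a: "a > 0" and b: "b > 0" and [measurable]: "f \<in> borel_measurable borel"
    and int: "integrable lborel (\<lambda>\<tau>. rl_kernel (a + b) (t - \<tau>) * f \<tau>)"
  shows "rl_integral a (rl_integral b f) t = rl_integral (a + b) f t"
    "integrable lborel (\<lambda>s. rl_kernel a (t - s) * rl_integral b f s)"
proof -
  define H where "H s \<tau> = rl_kernel a (t - s) * (rl_kernel b (s - \<tau>) * f \<tau>)" for s \<tau>
  have [measurable]: "case_prod H \<in> borel_measurable (lborel \<Otimes>\<^sub>M lborel)"
    unfolding H_def split_beta' by measurable
  have "(\<integral>\<^sup>+ p. ennreal (norm (case_prod H p)) \<partial>(lborel \<Otimes>\<^sub>M lborel))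
    = (\<integral>\<^sup>+ \<tau>. \<integral>\<^sup>+ s. ennreal (norm (H s \<tau>)) \<partial>lborel \<partial>lborel)"
    by (subst lborel_pair.nn_integral_snd[symmetric]) auto
  also have "\<dots> = (\<integral>\<^sup>+ \<tau>. ennreal \<bar>rl_kernel (a + b) (t - \<tau>) * f \<tau>\<bar> \<partial>lborel)"
  proof (rule nn_integral_cong)
    fix \<tau>
    have "(\<integral>\<^sup>+ s. ennreal (norm (H s \<tau>)) \<partial>lborel)
      = (\<integral>\<^sup>+ s. ennreal (rl_kernel a (t - s)) * ennreal (rl_kernel b (s - \<tau>)) * ennreal \<bar>f \<tau>\<bar>
      \<partial>lborel)"
      unfolding H_def using rl_kernel_nonneg a b
        by (intro nn_integral_cong) (simp add: abs_mult ennreal_mult mult.assoc)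
    also have "\<dots> = ennreal (rl_kernel (a + b) (t - \<tau>)) * ennreal \<bar>f \<tau>\<bar>"
      by (subst nn_integral_multc) (auto simp: nn_integral_rl_kernel[OF a b])
    finally show "(\<integral>\<^sup>+ s. ennreal (norm (H s \<tau>)) \<partial>lborel)
      = ennreal \<bar>rl_kernel (a + b) (t - \<tau>) * f \<tau>\<bar>"
      using rl_kernel_nonneg[of "a + b"] a b by (simp add: abs_mult ennreal_mult)
  qed
  also have "\<dots> < \<infinity>" using int unfolding integrable_iff_bounded by simp
  finally have intH: "integrable (lborel \<Otimes>\<^sub>M lborel) (case_prod H)"
    by (intro integrableI_bounded) auto
  have inner: "(LINT \<tau>|lborel. H s \<tau>) = rl_kernel a (t - s) * rl_integral b f s" for s
    unfolding H_def rl_integral_def by simp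
  have inner': "(LINT s|lborel. H s \<tau>) = rl_kernel (a + b) (t - \<tau>) * f \<tau>" for \<tau>
  proof -
    have "(LINT s|lborel. H s \<tau>) = (LINT s|lborel. rl_kernel a (t - s) * rl_kernel b (s - \<tau>) * f \<tau>)"
      unfolding H_def by (simp add: mult.assoc)
    also have "\<dots> = (LINT s|lborel. rl_kernel a (t - s) * rl_kernel b (s - \<tau>)) * f \<tau>"
      by (rule integral_mult_left_zero)
    finally show ?thesis using integral_rl_kernel(1)[OF a b] by simp
  qed
  show "integrable lborel (\<lambda>s. rl_kernel a (t - s) * rl_integral b f s)"
    using lborel_pair.integrable_fst[OF intH] by (simp add: inner)
  have "(LINT s|lborel. LINT \<tau>|lborel. H s \<tau>) = (LINT \<tau>|lborel. LINT s|lborel. H s \<tau>)"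
    using lborel_pair.Fubini_integral[OF intH] by simp
  thus "rl_integral a (rl_integral b f) t = rl_integral (a + b) f t"
    unfolding inner inner' by (simp add: rl_integral_def)
qed

text \<open>The regularity that the derivative of an absolutely continuous function has, with the
  lower limit 0 built into the support. Vanishing at 0 as well fixes a representative that can be
  compared pointwise with the cut functions below.\<close>

definition causal_L1 :: "(real \<Rightarrow> real) \<Rightarrow> bool" where
  "causal_L1 g \<longleftrightarrow> g \<in> borel_measurable borel \<and> (\<forall>t\<le>0. g t = 0)
    \<and> (\<forall>t. set_integrable lborel {0..t} g)"

lemma causal_L1_measurable [measurable_dest]: "causal_L1 g \<Longrightarrow> g \<in> borel_measurable borel"
  by (simp add: causal_L1_def)

lemma rl_integral_nonpos:
  assumes "\<And>\<tau>. \<tau> \<le> 0 \<Longrightarrow> g \<tau> = 0" "t \<le> 0"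
  shows "rl_integral a g t = 0"
proof -
  have "rl_kernel a (t - \<tau>) * g \<tau> = 0" for \<tau>
    using assms by (cases "\<tau> \<le> 0") (auto simp: rl_kernel_def)
  thus ?thesis unfolding rl_integral_def by (simp only: Bochner_Integration.integral_zero)
qed

lemma rl_kernel_one: "rl_kernel 1 s = (if s > 0 then 1 else 0)"
  by (simp add: rl_kernel_def)

lemma AE_rl_kernel_one:
  assumes "\<And>\<tau>. \<tau> \<le> 0 \<Longrightarrow> g \<tau> = 0"
  shows "AE \<tau> in lborel. rl_kernel 1 (t - \<tau>) * g \<tau> = indicator {0..t} \<tau> *\<^sub>R g \<tau>"
  using AE_lborel_singleton[of t]
  by eventually_elim (use assms in \<open>auto simp: rl_kernel_one indicator_def\<close>)

lemma rl_integral_one: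
  assumes [measurable]: "g \<in> borel_measurable borel" and "\<And>\<tau>. \<tau> \<le> 0 \<Longrightarrow> g \<tau> = 0"
  shows "rl_integral 1 g t = (LINT \<tau>:{0..t}|lborel. g \<tau>)"
  unfolding rl_integral_def set_lebesgue_integral_def
  by (intro integral_cong_AE) (use AE_rl_kernel_one[OF assms(2)] in auto)

lemma integrable_rl_kernel_one_iff:
  assumes [measurable]: "g \<in> borel_measurable borel" and "\<And>\<tau>. \<tau> \<le> 0 \<Longrightarrow> g \<tau> = 0"
  shows "integrable lborel (\<lambda>\<tau>. rl_kernel 1 (t - \<tau>) * g \<tau>) \<longleftrightarrow> set_integrable lborel {0..t} g"
  unfolding set_integrable_def
  by (intro integrable_cong_AE) (use AE_rl_kernel_one[OF assms(2)] in auto)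

text \<open>For \<open>c \<ge> 1\<close> the kernel is bounded by its value at \<open>t\<close>
  throughout \<open>(0, t)\<close>, so integrability of \<open>g\<close> suffices at every
  \<open>t\<close>. This is the source of the condition \<open>a + b \<ge> 1\<close> in the
  semigroup law.\<close>

lemma integrable_rl_kernel_ge_one:
  assumes g: "causal_L1 g" and c: "c \<ge> 1"
  shows "integrable lborel (\<lambda>\<tau>. rl_kernel c (t - \<tau>) * g \<tau>)"
proof (rule Bochner_Integration.integrable_bound)
  have [measurable]: "g \<in> borel_measurable borel" using g by (rule causal_L1_measurable)
  have Gc: "Gamma c > 0" using c by (simp add: Gamma_real_pos)
  show "integrable lborel (\<lambda>\<tau>. (t powr (c - 1) / Gamma c) * (indicator {0..t} \<tau> *\<^sub>R g \<tau>))"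
    using g by (intro integrable_mult_right) (auto simp: causal_L1_def set_integrable_def)
  show "AE \<tau> in lborel. norm (rl_kernel c (t - \<tau>) * g \<tau>)
    \<le> norm ((t powr (c - 1) / Gamma c) * (indicator {0..t} \<tau> *\<^sub>R g \<tau>))"
  proof (rule AE_I2)
    fix \<tau>
    consider "\<tau> \<le> 0" | "\<tau> \<ge> t" "\<tau> > 0" | "0 < \<tau>" "\<tau> < t" by linarith
    thus "norm (rl_kernel c (t - \<tau>) * g \<tau>)
      \<le> norm ((t powr (c - 1) / Gamma c) * (indicator {0..t} \<tau> *\<^sub>R g \<tau>))"
    proof cases
      case 1 thus ?thesis using g by (simp add: causal_L1_def)
    next
      case 2 thus ?thesis by (simp add: rl_kernel_def)
    next
      case 3
      hence "(t - \<tau>) powr (c - 1) \<le> t powr (c - 1)" using c by (intro powr_mono2) auto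
      thus ?thesis using 3 Gc
        by (auto simp: rl_kernel_def abs_mult intro!: divide_right_mono mult_right_mono)
    qed
  qed
  show "(\<lambda>\<tau>. rl_kernel c (t - \<tau>) * g \<tau>) \<in> borel_measurable lborel" by measurable
qed

lemma rl_integral_semigroup:
  assumes "causal_L1 g" "a > 0" "b > 0" "a + b \<ge> 1"
  shows "rl_integral a (rl_integral b g) t = rl_integral (a + b) g t"
    "integrable lborel (\<lambda>s. rl_kernel a (t - s) * rl_integral b g s)"
  using rl_integral_rl_integral[OF assms(2,3) _ integrable_rl_kernel_ge_one[OF assms(1,4)]]
    causal_L1_measurable[OF assms(1)] by auto

lemma rl_integral_measurable [measurable]:
  assumes [measurable]: "g \<in> borel_measurable borel"
  shows "rl_integral a g \<in> borel_measurable borel"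
  unfolding rl_integral_def by measurable

text \<open>Local integrability is integrability against \<open>rl_kernel 1\<close>, so it is the
  semigroup law with outer order 1, where the orders add up to more than 1 whatever \<open>b\<close>
  is.\<close>

lemma causal_L1_rl_integral:
  assumes g: "causal_L1 g" and b: "b > 0"
  shows "causal_L1 (rl_integral b g)"
proof -
  have [measurable]: "g \<in> borel_measurable borel" using g by (rule causal_L1_measurable)
  have z: "rl_integral b g t = 0" if "t \<le> 0" for t
    using g that by (intro rl_integral_nonpos) (auto simp: causal_L1_def)
  have "integrable lborel (\<lambda>s. rl_kernel 1 (t - s) * rl_integral b g s)" for t
    using rl_integral_semigroup(2)[OF g, of 1 b] b by simp
  thus ?thesis using z integrable_rl_kernel_one_iff[of "rl_integral b g"]
    by (auto simp: causal_L1_def)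
qed

section \<open>Kernels and continuous functions under fractional integration\<close>

lemma rl_kernel_eq_0: "s \<le> 0 \<Longrightarrow> rl_kernel a s = 0"
  by (simp add: rl_kernel_def)

text \<open>\<open>rl_kernel 1\<close> is the unit step, so \<open>b = 1\<close> gives the
  fractional integral of a constant, and general \<open>b\<close> shows how the singular part of a
  density is transformed.\<close>

lemma rl_integral_rl_kernel:
  assumes "a > 0" "b > 0"
  shows "rl_integral a (rl_kernel b) t = rl_kernel (a + b) t"
    "integrable lborel (\<lambda>s. rl_kernel a (t - s) * rl_kernel b s)"
  using integral_rl_kernel[OF assms, of t 0] by (simp_all add: rl_integral_def)

lemma causal_L1_rl_kernel:
  assumes "b > 0"
  shows "causal_L1 (rl_kernel b)"
  using rl_integral_rl_kernel(2)[of 1 b] assms integrable_rl_kernel_one_iff[of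
    "rl_kernel b"] rl_kernel_eq_0
  by (auto simp: causal_L1_def)

lemma rl_integral_lincomb:
  assumes "integrable lborel (\<lambda>s. rl_kernel a (t - s) * f s)"
    "integrable lborel (\<lambda>s. rl_kernel a (t - s) * g s)"
  shows "rl_integral a (\<lambda>s. c * f s + g s) t = c * rl_integral a f t + rl_integral a g t"
    "integrable lborel (\<lambda>s. rl_kernel a (t - s) * (c * f s + g s))"
proof -
  have eq: "(\<lambda>s. rl_kernel a (t - s) * (c * f s + g s))
    = (\<lambda>s. c * (rl_kernel a (t - s) * f s) + rl_kernel a (t - s) * g s)"
    by (simp add: algebra_simps)
  show "rl_integral a (\<lambda>s. c * f s + g s) t = c * rl_integral a f t + rl_integral a g t"
    "integrable lborel (\<lambda>s. rl_kernel a (t - s) * (c * f s + g s))"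
    unfolding rl_integral_def eq using assms by auto
qed

lemma causal_L1_lincomb:
  assumes "causal_L1 f" "causal_L1 g"
  shows "causal_L1 (\<lambda>s. c * f s + g s)"
  using assms by (auto simp: causal_L1_def intro!: set_integral_add set_integrable_mult_right)

text \<open>The equations prescribe fractional derivatives only at \<open>t > 0\<close>, hence the cut at \<open>t = 0\<close>.\<close>

definition restrict_pos :: "(real \<Rightarrow> real) \<Rightarrow> real \<Rightarrow> real" where
  "restrict_pos f t = (if t > 0 then f t else 0)"

lemma restrict_pos_measurable:
  assumes "continuous_on {0..} f"
  shows "restrict_pos f \<in> borel_measurable borel"
proof -
  have "(\<lambda>t. indicator {0<..} t *\<^sub>R f t) \<in> borel_measurable borel"
    using assms by (intro borel_measurable_continuous_on_indicator continuous_on_subset[OF assms])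
      auto
  moreover have "restrict_pos f = (\<lambda>t. indicator {0<..} t *\<^sub>R f t)"
    by (auto simp: restrict_pos_def fun_eq_iff)
  ultimately show ?thesis by simp
qed

text \<open>A continuous function is bounded on \<open>{0..t}\<close>, which admits every positive
  order at every \<open>t\<close>. The factor \<open>rl_kernel 1\<close> in the majorant is the unit
  step that cuts off negative arguments.\<close>

lemma integrable_rl_kernel_continuous:
  assumes f: "continuous_on {0..} f" and a: "a > 0"
  shows "integrable lborel (\<lambda>\<tau>. rl_kernel a (t - \<tau>) * restrict_pos f \<tau>)"
proof -
  have [measurable]: "restrict_pos f \<in> borel_measurable borel"
    by (rule restrict_pos_measurable[OF f])
  have "compact (f ` {0..t})" by (intro compact_continuous_image continuous_on_subset[OF f]) auto
  then obtain B where B: "\<And>\<tau>. \<tau> \<in> {0..t} \<Longrightarrow> \<bar>f \<tau>\<bar> \<le> B"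
    using compact_imp_bounded bounded_iff by (metis image_eqI real_norm_def)
  show ?thesis
  proof (rule Bochner_Integration.integrable_bound)
    show "integrable lborel (\<lambda>\<tau>. B * (rl_kernel a (t - \<tau>) * rl_kernel 1 \<tau>))"
      using rl_integral_rl_kernel(2)[of a 1] a by (intro integrable_mult_right) auto
    show "AE \<tau> in lborel. norm (rl_kernel a (t - \<tau>) * restrict_pos f \<tau>)
      \<le> norm (B * (rl_kernel a (t - \<tau>) * rl_kernel 1 \<tau>))"
    proof (rule AE_I2)
      fix \<tau>
      consider "\<tau> \<le> 0" | "\<tau> \<ge> t" | "0 < \<tau>" "\<tau> < t" by linarith
      thus "norm (rl_kernel a (t - \<tau>) * restrict_pos f \<tau>)
        \<le> norm (B * (rl_kernel a (t - \<tau>) * rl_kernel 1 \<tau>))"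
      proof cases
        case 3
        hence "\<bar>f \<tau>\<bar> \<le> \<bar>B\<bar>" using B[of \<tau>] by auto
        hence "\<bar>rl_kernel a (t - \<tau>)\<bar> * \<bar>f \<tau>\<bar> \<le> \<bar>rl_kernel a (t - \<tau>)\<bar> * \<bar>B\<bar>"
          by (rule mult_left_mono) simp
        thus ?thesis using 3 by (simp add: restrict_pos_def rl_kernel_one abs_mult mult.commute)
      qed (auto simp: restrict_pos_def rl_kernel_def)
    qed
    show "(\<lambda>\<tau>. rl_kernel a (t - \<tau>) * restrict_pos f \<tau>) \<in> borel_measurable lborel" by measurable
  qed
qed

text \<open>
  The kernel need not be small, but its integral against \<open>exp (- n s)\<close> is for large \<open>n\<close>. So the
  supremum of \<open>exp (- n s) \<phi> s\<close> over \<open>[0, t]\<close> is at most half of itself.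
\<close>

lemma volterra_unique:
  fixes \<phi> \<kappa> :: "real \<Rightarrow> real"
  assumes cont: "continuous_on {0..} \<phi>" and nonneg: "\<And>t. t \<ge> 0 \<Longrightarrow> \<phi> t \<ge> 0"
    and \<kappa>: "causal_L1 \<kappa>" "\<And>s. \<kappa> s \<ge> 0"
    and le: "\<And>t. t \<ge> 0 \<Longrightarrow> \<phi> t \<le> (LINT \<tau>|lborel. \<kappa> (t - \<tau>) * restrict_pos \<phi> \<tau>)"
    and t: "t \<ge> 0"
  shows "\<phi> t = 0"
proof -
  have [measurable]: "\<kappa> \<in> borel_measurable borel" using \<kappa>(1) by (rule causal_L1_measurable)
  have \<kappa>i: "integrable lborel (\<lambda>s. indicator {0..t} s * \<kappa> s)" using \<kappa>
    by (auto simp: causal_L1_def set_integrable_def)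
  \<comment> \<open>Where \<open>s > 0\<close> the exponential decays, and for
    \<open>s \<le> 0\<close>, where it does not, \<open>\<kappa>\<close> vanishes. The kernel itself
    is the integrable majorant.\<close>
  have "(\<lambda>n. LINT s|lborel. indicator {0..t} s * \<kappa> s * exp (- real n * s))
    \<longlonglongrightarrow> (LINT s|(lborel::real measure). 0)"
  proof (rule integral_dominated_convergence[where w="\<lambda>s. indicator {0..t} s * \<kappa> s"])
    show "AE s in lborel. (\<lambda>n. indicator {0..t} s * \<kappa> s * exp (- real n * s)) \<longlonglongrightarrow> 0"
    proof (rule AE_I2)
      fix s
      show "(\<lambda>n. indicator {0..t} s * \<kappa> s * exp (- real n * s)) \<longlonglongrightarrow> 0"
      proof (cases "s > 0")
        case True
        have "(\<lambda>n. exp (- s) ^ n) \<longlonglongrightarrow> 0" using True by (intro LIMSEQ_realpow_zero) auto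
        hence "(\<lambda>n. exp (- real n * s)) \<longlonglongrightarrow> 0" by (simp add: exp_of_nat_mult[symmetric])
        thus ?thesis by (rule tendsto_mult_right_zero)
      next
        case False
        hence "\<kappa> s = 0" using \<kappa> by (simp add: causal_L1_def)
        thus ?thesis by simp
      qed
    qed
    show "AE s in lborel. norm (indicator {0..t} s * \<kappa> s * exp (- real n * s))
      \<le> indicator {0..t} s * \<kappa> s" for n
      using \<kappa>(2) by (intro AE_I2) (auto simp: indicator_def abs_mult intro!: mult_left_le)
  qed (use \<kappa>i in auto)
  hence "\<forall>\<^sub>F n in sequentially. (LINT s|lborel. indicator {0..t} s * \<kappa> s * exp (- real n * s))
    < 1/2"
    by (intro order_tendstoD(2)[where a="1/2"]) auto
  hence "\<exists>n. (LINT s|lborel. indicator {0..t} s * \<kappa> s * exp (- real n * s)) < 1/2"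
    by (rule eventually_happens'[OF sequentially_bot])
  then obtain n :: nat where n: "(LINT s|lborel. indicator {0..t} s * \<kappa> s * exp (- real n * s))
    < 1/2" ..
  have ei: "integrable lborel (\<lambda>s. indicator {0..t} s * \<kappa> s * exp (- real n * s))"
    by (rule Bochner_Integration.integrable_bound[OF \<kappa>i])
       (use \<kappa>(2) in \<open>auto simp: indicator_def abs_mult intro!: mult_left_le\<close>)
  define \<psi> where "\<psi> s = exp (- real n * s) * \<phi> s" for s
  have "continuous_on {0..t} \<psi>" unfolding \<psi>_def
    by (intro continuous_intros continuous_on_subset[OF cont]) auto
  then obtain r where r: "r \<in> {0..t}" "\<And>s. s \<in> {0..t} \<Longrightarrow> \<psi> s \<le> \<psi> r"
    using continuous_attains_sup[of "{0..t}" \<psi>] t by auto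
  have \<phi>r: "\<phi> s \<le> exp (real n * s) * \<psi> r" if "s \<in> {0..t}" for s
    using r(2)[OF that] by (simp add: \<psi>_def exp_minus field_simps)
  have \<psi>r: "\<psi> r \<ge> 0" using nonneg[of r] r by (simp add: \<psi>_def)
  let ?e = "\<lambda>s. indicator {0..t} s * \<kappa> s * exp (- real n * s)"
  have er: "integrable lborel (\<lambda>\<tau>. ?e (r - \<tau>))"
    using ei lborel_integrable_real_affine[of "\<lambda>s. ?e s" "-1" r] by simp
  have "\<phi> r \<le> (LINT \<tau>|lborel. \<kappa> (r - \<tau>) * restrict_pos \<phi> \<tau>)" using le r by auto
  also have "\<dots> \<le> (LINT \<tau>|lborel. (exp (real n * r) * \<psi> r) * ?e (r - \<tau>))"
  proof (rule integral_mono')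
    show "integrable lborel (\<lambda>\<tau>. (exp (real n * r) * \<psi> r) * ?e (r - \<tau>))" using er
      by (intro integrable_mult_right)
    fix \<tau>
    consider "\<tau> \<le> 0" | "\<tau> \<ge> r" | "0 < \<tau>" "\<tau> < r" by linarith
    thus "\<kappa> (r - \<tau>) * restrict_pos \<phi> \<tau> \<le> (exp (real n * r) * \<psi> r) * ?e (r - \<tau>)"
    proof cases
      case 1 thus ?thesis using \<kappa>(2) \<psi>r by (simp add: restrict_pos_def)
    next
      case 2
      hence "\<kappa> (r - \<tau>) = 0" using \<kappa> by (simp add: causal_L1_def)
      thus ?thesis by simp
    next
      case 3
      have "\<kappa> (r - \<tau>) * \<phi> \<tau> \<le> \<kappa> (r - \<tau>) * (exp (real n * \<tau>) * \<psi> r)"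
        using \<phi>r[of \<tau>] 3 r \<kappa>(2) by (intro mult_left_mono) auto
      \<comment> \<open>The weight at \<open>\<tau>\<close> is split into the weight at the maximum
        point \<open>r\<close> and a decaying factor in \<open>r - \<tau>\<close>, which is absorbed
        into the kernel.\<close>
      also have "exp (real n * \<tau>) = exp (real n * r) * exp (- real n * (r - \<tau>))"
        by (simp add: exp_add[symmetric] algebra_simps)
      finally show ?thesis using 3 r by (simp add: algebra_simps restrict_pos_def)
    qed
    show "0 \<le> (exp (real n * r) * \<psi> r) * ?e (r - \<tau>)" using \<psi>r \<kappa>(2) by simp
  qed
  also have "\<dots> = (exp (real n * r) * \<psi> r) * (LINT \<tau>|lborel. ?e (r - \<tau>))" by simp
  also have "(LINT \<tau>|lborel. ?e (r - \<tau>)) = (LINT s|lborel. ?e s)"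
    using lborel_integral_real_affine[of "-1" ?e r] by simp
  also have "(exp (real n * r) * \<psi> r) * (LINT s|lborel. ?e s) \<le> (exp (real n * r) * \<psi> r) * (1/2)"
    using n \<psi>r by (intro mult_left_mono) auto
  finally have "\<phi> r \<le> exp (real n * r) * \<psi> r * (1/2)" .
  also have "exp (real n * r) * \<psi> r = \<phi> r" by (simp add: \<psi>_def exp_minus)
  finally have "\<phi> r \<le> 0" by simp
  hence "\<psi> r \<le> 0" by (simp add: \<psi>_def mult_le_0_iff)
  hence "\<phi> t \<le> 0" using \<phi>r[of t] \<psi>r t by simp
  thus ?thesis using nonneg[OF t] by simp
qed

section \<open>Derivatives of indefinite integrals\<close>

text \<open>Derivatives within \<open>{0..}\<close> never see negative arguments. This matters
  because a solution of the system determines \<open>x\<close> only on the half-line.\<close>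

lemma hderiv_cong:
  assumes "\<And>t. t \<ge> 0 \<Longrightarrow> f t = g t" "t \<ge> 0"
  shows "hderiv n f t = hderiv n g t"
  using assms(2)
proof (induction n arbitrary: t)
  case 0
  then show ?case using assms by (simp add: hderiv_def)
next
  case (Suc n)
  have "(hderiv n f has_vector_derivative D) (at t within {0..}) \<longleftrightarrow>
        (hderiv n g has_vector_derivative D) (at t within {0..})" for D
    using has_vector_derivative_transform[of t "{0..}" "hderiv n f" "hderiv n g"]
      has_vector_derivative_transform[of t "{0..}" "hderiv n g" "hderiv n f"] Suc by auto
  hence "vector_derivative (hderiv n f) (at t within {0..})
    = vector_derivative (hderiv n g) (at t within {0..})"
    unfolding vector_derivative_def by simp
  thus ?case by (simp add: hderiv_def)
qed

lemma hderiv_0 [simp]: "hderiv 0 f = f"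
  by (simp add: hderiv_def)

lemma hderiv_Suc: "hderiv (Suc n) f t = vector_derivative (hderiv n f) (at t within {0..})"
  by (simp add: hderiv_def)

lemma hderiv_one: "hderiv 1 (hderiv n f) = hderiv (Suc n) f"
  by (simp add: hderiv_def)

lemma hderiv_Suc_eqI:
  assumes "(hderiv n f has_vector_derivative D) (at t within {0..})" "t \<ge> 0"
  shows "hderiv (Suc n) f t = D"
proof -
  have "t islimpt {t<..<t + 1}" by (rule islimpt_greaterThanLessThan1) simp
  hence "t islimpt {0..}" by (rule islimpt_subset) (use assms(2) in auto)
  thus ?thesis unfolding hderiv_Suc
    by (intro vector_derivative_within[OF _ assms(1)]) (simp add: trivial_limit_within)
qed

section \<open>Lebesgue differentiation on the line\<close>

lemma AE_right_derivative_indefinite_integral: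
  fixes g :: "real \<Rightarrow> real"
  assumes int: "\<And>a b. g integrable_on {a..b}"
  shows "AE x in lebesgue. ((\<lambda>h. integral {x..x + h} g / h) \<longlongrightarrow> g x) (at_right 0)"
proof -
  obtain N where N: "negligible N" "\<And>x e. \<lbrakk>x \<notin> N; 0 < e\<rbrakk> \<Longrightarrow>
      \<exists>d>0. \<forall>h. 0 < h \<and> h < d \<longrightarrow> norm (integral (cbox x (x + h *\<^sub>R One)) g /\<^sub>R h ^ DIM(real) - g x)
        < e"
    using integrable_ccontinuous_explicit[of g] int by auto
  have "((\<lambda>h. integral {x..x + h} g / h) \<longlongrightarrow> g x) (at_right 0)" if "x \<notin> N" for x
    unfolding tendsto_iff eventually_at_right_field
  proof (intro allI impI)
    fix e :: real assume "e > 0"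
    from N(2)[OF that this] obtain d where "d > 0" "\<And>h. 0 < h \<Longrightarrow> h < d
      \<Longrightarrow> norm (integral {x..x + h} g / h - g x) < e"
      by (auto simp: divide_inverse mult.commute)
    thus "\<exists>b>0. \<forall>y>0. y < b \<longrightarrow> dist (integral {x..x + y} g / y) (g x) < e"
      by (auto simp: dist_norm)
  qed
  thus ?thesis using N(1) by (intro AE_I'[of N]) (auto simp: negligible_iff_null_sets)
qed

text \<open>The right-hand difference quotients come directly from the preceding lemma, the
  left-hand ones from the same lemma for the reflected function \<open>g (- x)\<close> at
  \<open>- x\<close>; reflection carries its exceptional null set to a null set.\<close>

lemma AE_derivative_indefinite_integral:
  fixes g :: "real \<Rightarrow> real"
  assumes int: "\<And>a b. g integrable_on {a..b}"
    and F: "\<And>a b. a \<le> b \<Longrightarrow> F b - F a = integral {a..b} g"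
  shows "AE x in lebesgue. (F has_real_derivative g x) (at x)"
proof -
  have int': "(\<lambda>x. g (- x)) integrable_on {a..b}" for a b
    using int[of "-b" "-a"] Henstock_Kurzweil_Integration.integrable_reflect_real[where f=g and
      a="-b" and b="-a"] by simp
  have "AE x in lebesgue. ((\<lambda>h. integral {x..x + h} (\<lambda>x. g (- x)) / h) \<longlongrightarrow> g (- x)) (at_right 0)"
    by (rule AE_right_derivative_indefinite_integral[OF int'])
  then obtain N where N: "N \<in> null_sets lebesgue"
    "\<And>x. x \<notin> N \<Longrightarrow> ((\<lambda>h. integral {x..x + h} (\<lambda>x. g (- x)) / h) \<longlongrightarrow> g (- x)) (at_right 0)"
    by (elim AE_E3) auto
  have "uminus ` N \<in> null_sets lebesgue"
    using N(1) negligible_differentiable_image_negligible[of N uminus]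
    by (simp add: negligible_iff_null_sets differentiable_on_minus)
  hence "AE x in lebesgue. ((\<lambda>h. integral {- x..- x + h} (\<lambda>x. g (- x)) / h) \<longlongrightarrow> g x) (at_right 0)"
  proof (rule AE_I')
    show "{x \<in> space lebesgue. \<not> ((\<lambda>h. integral {- x..- x + h} (\<lambda>x. g (- x)) / h) \<longlongrightarrow> g x)
      (at_right 0)} \<subseteq> uminus ` N"
    proof clarify
      fix x assume "\<not> ((\<lambda>h. integral {- x..- x + h} (\<lambda>x. g (- x)) / h) \<longlongrightarrow> g x) (at_right 0)"
      hence "- x \<in> N" using N(2)[of "- x"] by auto
      thus "x \<in> uminus ` N" by (rule rev_image_eqI) simp
    qed
  qed
  with AE_right_derivative_indefinite_integral[OF int] show ?thesis
  proof eventually_elim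
    case (elim x)
    have "((\<lambda>h. (F (x + h) - F x) / h) \<longlongrightarrow> g x) (at_right 0)"
      using elim(1) by (rule Lim_transform_eventually) (auto simp: eventually_at_right_field F
        intro!: exI[of _ 1])
    moreover have "((\<lambda>h. (F (x + h) - F x) / h) \<longlongrightarrow> g x) (at_left 0)"
    proof -
      have "((\<lambda>h. (F (x + - h) - F x) / - h) \<longlongrightarrow> g x) (at_right 0)"
        using elim(2)
      proof (rule Lim_transform_eventually)
        have "integral {- x..- x + h} (\<lambda>x. g (- x)) / h = (F (x + - h) - F x) / - h" if "h > 0"
          for h
          using F[of "x - h" x] that Henstock_Kurzweil_Integration.integral_reflect_real[of x
            "x-h" g] by (simp add: field_simps)
        thus "\<forall>\<^sub>F h in at_right 0. integral {- x..- x + h} (\<lambda>x. g (- x)) / h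
          = (F (x + - h) - F x) / - h"
          by (auto simp: eventually_at_right_field intro!: exI[of _ 1])
      qed
      thus ?thesis by (subst filterlim_at_left_to_right) simp
    qed
    ultimately show ?case unfolding DERIV_def
      by (intro filterlim_split_at)
  qed
qed

definition has_density :: "(real \<Rightarrow> real) \<Rightarrow> (real \<Rightarrow> real) \<Rightarrow> bool" where
  "has_density f g \<longleftrightarrow> causal_L1 g \<and> (\<forall>t\<ge>0. f t = f 0 + (LINT \<tau>:{0..t}|lborel. g \<tau>))"

text \<open>\<open>hderiv 1 f\<close> is unspecified where \<open>f\<close> has no derivative. Under
  an integral it may now be replaced by the Borel function \<open>g\<close>. The primitive is
  extended by 0 to negative arguments, since the differentiation lemma works on the whole
  line.\<close>

lemma AE_hderiv_density:
  assumes "has_density f g"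
  shows "AE t in lebesgue. t > 0 \<longrightarrow> f differentiable (at t within {0..}) \<and> hderiv 1 f t = g t"
proof -
  have [measurable]: "g \<in> borel_measurable borel" and gi: "\<And>t. set_integrable lborel {0..t} g" and
    f: "\<And>t. t \<ge> 0 \<Longrightarrow> f t = f 0 + (LINT \<tau>:{0..t}|lborel. g \<tau>)"
    using assms unfolding has_density_def causal_L1_def by blast+
  define g' where "g' x = indicator {0..} x * g x" for x
  have g'i: "set_integrable lborel {a..b} g'" for a b
  proof -
    have "set_integrable lborel {max 0 a..b} g"
      using set_integrable_subset[OF gi[of b], of "{max 0 a..b}"] by auto
    moreover have "(\<lambda>x. indicator {max 0 a..b} x *\<^sub>R g x) = (\<lambda>x. indicator {a..b} x *\<^sub>R g' x)"
      by (auto simp: g'_def indicator_def)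
    ultimately show ?thesis unfolding set_integrable_def by simp
  qed
  have int: "g' integrable_on {a..b}" for a b using set_borel_integral_eq_integral(1)[OF g'i] .
  define F where "F x = (if x \<ge> 0 then integral {0..x} g' else 0)" for x
  have F: "F b - F a = integral {a..b} g'" if "a \<le> b" for a b
  proof -
    have neg: "integral {a..b} g' = 0" if "b \<le> 0" for a b
    proof -
      have "integral {a..b} g' = integral {a..b} (\<lambda>x. 0)"
        by (rule integral_spike[of "{0}"]) (use that in \<open>auto simp: g'_def\<close>)
      thus ?thesis by simp
    qed
    consider "b < 0" | "a < 0" "b \<ge> 0" | "a \<ge> 0" by linarith
    thus ?thesis
    proof cases
      case 1 thus ?thesis using that neg[of b a] by (simp add: F_def)
    next
      case 2
      thus ?thesis using Henstock_Kurzweil_Integration.integral_combine[OF _ _ int, of a 0 b] neg[of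
        0 a] by (simp add: F_def)
    next
      case 3
      thus ?thesis using Henstock_Kurzweil_Integration.integral_combine[OF _ _ int, of 0 a b] that
        by (simp add: F_def)
    qed
  qed
  have fF: "f t = f 0 + F t" if "t \<ge> 0" for t
  proof -
    have "(LINT \<tau>:{0..t}|lborel. g \<tau>) = (LINT \<tau>:{0..t}|lborel. g' \<tau>)"
      unfolding set_lebesgue_integral_def
        by (intro Bochner_Integration.integral_cong) (auto simp: g'_def indicator_def)
    also have "\<dots> = F t" using set_borel_integral_eq_integral(2)[OF g'i, of 0 t] that
      by (simp add: F_def)
    finally show ?thesis using f[OF that] by simp
  qed
  have "AE t in lebesgue. (F has_real_derivative g' t) (at t)"
    by (rule AE_derivative_indefinite_integral[OF int]) (rule F)
  thus ?thesis
  proof eventually_elim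
    case (elim t)
    show ?case
    proof
      assume t: "t > 0"
      have "((\<lambda>t. f 0 + F t) has_real_derivative g' t) (at t within {0..})"
        using has_field_derivative_at_within[OF DERIV_add[OF DERIV_const elim]] by simp
      hence "((\<lambda>t. f 0 + F t) has_vector_derivative g' t) (at t within {0..})"
        by (simp add: has_real_derivative_iff_has_vector_derivative)
      hence "(f has_vector_derivative g' t) (at t within {0..})"
        by (rule has_vector_derivative_transform[rotated 2]) (use t in simp, rule fF, simp)
      hence *: "(hderiv 0 f has_vector_derivative g t) (at t within {0..})" using t
        by (simp add: g'_def)
      show "f differentiable (at t within {0..}) \<and> hderiv 1 f t = g t"
        using hderiv_Suc_eqI[OF *] t * by (auto simp: differentiableI_vector)
    qed
  qed
qed

section \<open>Absolute continuity of indefinite integrals\<close>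

lemma integral_abs_continuous:
  assumes g: "integrable M (g :: 'a \<Rightarrow> real)" and e: "e > 0"
  obtains \<delta> where "\<delta> > 0" "\<And>A. A \<in> sets M \<Longrightarrow> emeasure M A < ennreal \<delta> \<Longrightarrow> (LINT x:A|M. \<bar>g x\<bar>) < e"
proof -
  have [measurable]: "g \<in> borel_measurable M" using g by simp
  \<comment> \<open>Truncation at height \<open>n\<close>: the excess of
    \<open>\<bar>g\<bar>\<close> over \<open>n\<close> has small integral for large
    \<open>n\<close>, and what remains is bounded, hence small on small sets.\<close>
  have "(\<lambda>n. LINT x|M. max 0 (\<bar>g x\<bar> - real n)) \<longlonglongrightarrow> (LINT x|M. 0)"
  proof (rule integral_dominated_convergence[where w="\<lambda>x. \<bar>g x\<bar>"])
    show "AE x in M. (\<lambda>n. max 0 (\<bar>g x\<bar> - real n)) \<longlonglongrightarrow> 0"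
    proof (rule AE_I2)
      fix x
      obtain n0 where "\<bar>g x\<bar> \<le> real n0" using real_arch_simple by blast
      hence "\<forall>\<^sub>F n in sequentially. max 0 (\<bar>g x\<bar> - real n) = 0"
        by (auto simp: eventually_sequentially intro!: exI[of _ n0])
      thus "(\<lambda>n. max 0 (\<bar>g x\<bar> - real n)) \<longlonglongrightarrow> 0" by (simp add: tendsto_eventually)
    qed
  qed (use g in auto)
  hence "\<forall>\<^sub>F n in sequentially. (LINT x|M. max 0 (\<bar>g x\<bar> - real n)) < e/2"
    using e by (intro order_tendstoD(2)[where a="e/2"]) auto
  hence "\<exists>n. (LINT x|M. max 0 (\<bar>g x\<bar> - real n)) < e/2"
    by (rule eventually_happens'[OF sequentially_bot])
  then obtain n :: nat where n: "(LINT x|M. max 0 (\<bar>g x\<bar> - real n)) < e/2" ..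
  have mi: "integrable M (\<lambda>x. max 0 (\<bar>g x\<bar> - real n))"
    by (rule Bochner_Integration.integrable_bound[OF g]) auto
  show ?thesis
  \<comment> \<open>Chosen so that the bounded part contributes at most \<open>n\<close> times this
    number, which is at most \<open>e/2\<close>; the summand 1 covers \<open>n = 0\<close>.\<close>
  proof (rule that[of "e / (2 * (real n + 1))"])
    show "e / (2 * (real n + 1)) > 0" using e by simp
    fix A assume A: "A \<in> sets M" and em: "emeasure M A < ennreal (e / (2 * (real n + 1)))"
    have fin: "emeasure M A < \<infinity>" using less_trans[OF em ennreal_less_top] by simp
    have mA: "measure M A < e / (2 * (real n + 1))"
      using em fin e by (simp add: emeasure_eq_ennreal_measure less_top ennreal_less_iff)
    have "(LINT x:A|M. \<bar>g x\<bar>) \<le> (LINT x|M. max 0 (\<bar>g x\<bar> - real n) + real n * indicator A x)"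
      unfolding set_lebesgue_integral_def
    proof (rule integral_mono)
      show "integrable M (\<lambda>x. indicat_real A x *\<^sub>R \<bar>g x\<bar>)" using g A
        by (intro integrable_mult_indicator) auto
      show "integrable M (\<lambda>x. max 0 (\<bar>g x\<bar> - real n) + real n * indicator A x)"
        using mi A fin by (intro Bochner_Integration.integrable_add integrable_mult_right
          integrable_real_indicator) auto
    qed (auto simp: indicator_def)
    also have "\<dots> = (LINT x|M. max 0 (\<bar>g x\<bar> - real n)) + real n * measure M A"
      using mi A fin by (subst Bochner_Integration.integral_add) auto
    also have "real n * measure M A \<le> real n * (e / (2 * (real n + 1)))" using mA
      by (intro mult_left_mono) auto
    also have "\<dots> \<le> e / 2" using e by (simp add: field_simps)
    finally show "(LINT x:A|M. \<bar>g x\<bar>) < e" using n by linarith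
  qed
qed

text \<open>Each increment of \<open>f\<close> is bounded by the integral of the modulus of the
  density over the cell, so their sum is bounded by the integral over the union, whose measure is
  the total length.\<close>

lemma abs_continuous_on_density:
  assumes d: "has_density f g" and T: "T > 0"
  shows "abs_continuous_on 0 T f"
  unfolding abs_continuous_on_def
proof (intro allI impI)
  fix \<epsilon> :: real assume e: "\<epsilon> > 0"
  have [measurable]: "g \<in> borel_measurable borel" and gi: "\<And>t. set_integrable lborel {0..t} g" and
    f: "\<And>t. t \<ge> 0 \<Longrightarrow> f t = f 0 + (LINT \<tau>:{0..t}|lborel. g \<tau>)"
    using d unfolding has_density_def causal_L1_def by blast+
  have gT: "integrable lborel (\<lambda>x. indicator {0..T} x * g x)" using gi[of T]
    by (simp add: set_integrable_def)
  obtain \<delta> where dl: "\<delta> > 0" "\<And>A. A \<in> sets lborel \<Longrightarrow> emeasure lborel A < ennreal \<delta> \<Longrightarrow>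
      (LINT x:A|lborel. \<bar>indicator {0..T} x * g x\<bar>) < \<epsilon>"
    using integral_abs_continuous[OF gT e] by blast
  have fd: "\<bar>f q - f p\<bar> \<le> (LINT x:{p..q}|lborel. \<bar>indicator {0..T} x * g x\<bar>)"
    if "0 \<le> p" "p \<le> q" "q \<le> T" for p q
  proof -
    have "f q - f p = (LINT \<tau>:{0..q}|lborel. g \<tau>) - (LINT \<tau>:{0..p}|lborel. g \<tau>)"
      using f[of p] f[of q] that by simp
    also have "\<dots> = (LINT \<tau>:{p<..q}|lborel. g \<tau>)"
    proof -
      have "{0..q} = {0..p} \<union> {p<..q}" using that by auto
      moreover have "{0..p} \<inter> {p<..q} = {}" by auto
      moreover have "set_integrable lborel {p<..q} g"
        by (rule set_integrable_subset[OF gi[of q]]) (use that in auto)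
      ultimately show ?thesis using set_integral_Un[of "{0..p}" "{p<..q}" lborel g] gi[of p] by auto
    qed
    also have "\<bar>\<dots>\<bar> \<le> (LINT \<tau>:{p<..q}|lborel. \<bar>g \<tau>\<bar>)"
    proof -
      have "set_integrable lborel {p<..q} g"
        by (rule set_integrable_subset[OF gi[of q]]) (use that in auto)
      thus ?thesis using set_integral_norm_bound[of lborel "{p<..q}" g] by simp
    qed
    also have "\<dots> \<le> (LINT x:{p..q}|lborel. \<bar>indicator {0..T} x * g x\<bar>)"
      unfolding set_lebesgue_integral_def
    proof (rule integral_mono)
      show "integrable lborel (\<lambda>x. indicat_real {p<..q} x *\<^sub>R \<bar>g x\<bar>)"
      proof -
        have "set_integrable lborel {p<..q} g"
          by (rule set_integrable_subset[OF gi[of q]]) (use that in auto)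
        from set_integrable_abs[OF this] show ?thesis by (simp add: set_integrable_def)
      qed
      show "integrable lborel (\<lambda>x. indicat_real {p..q} x *\<^sub>R \<bar>indicat_real {0..T} x * g x\<bar>)"
        using gT by (intro integrable_mult_indicator) auto
    qed (use that in \<open>auto simp: indicator_def\<close>)
    finally show ?thesis .
  qed
  show "\<exists>\<delta>>0. \<forall>\<D>. \<D> division_of \<Union> \<D> \<and> \<Union> \<D> \<subseteq> {0..T} \<and> (\<Sum>K\<in>\<D>. Sup K - Inf K) < \<delta> \<longrightarrow>
     (\<Sum>K\<in>\<D>. \<bar>f (Sup K) - f (Inf K)\<bar>) < \<epsilon>"
  proof (intro exI conjI allI impI, rule dl(1), elim conjE)
    fix D assume D: "D division_of \<Union> D" "\<Union> D \<subseteq> {0..T}" "(\<Sum>K\<in>D. Sup K - Inf K) < \<delta>"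
    have fin: "finite D" using D by auto
    have KT: "0 \<le> Inf K" "Inf K \<le> Sup K" "Sup K \<le> T" "K = {Inf K..Sup K}" if K: "K \<in> D" for K
    proof -
      obtain p q where pq: "p \<le> q" "K = {p..q}" "Inf K = p" "Sup K = q"
          using division_elem_real[OF D(1) K] by blast
      have "{p..q} \<subseteq> {0..T}" using K D(2) pq by blast
      thus "0 \<le> Inf K" "Inf K \<le> Sup K" "Sup K \<le> T" "K = {Inf K..Sup K}" using pq by auto
    qed
    have bor: "K \<in> sets lborel" if "K \<in> D" for K by (subst KT(4)[OF that]) simp
    have "(\<Sum>K\<in>D. \<bar>f (Sup K) - f (Inf K)\<bar>) \<le> (\<Sum>K\<in>D. (LINT x:K|lborel. \<bar>indicator {0..T} x * g x\<bar>))"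
      using fd KT by (intro sum_mono) metis
    also have "\<dots> = (LINT x:\<Union>D|lborel. \<bar>indicator {0..T} x * g x\<bar>)"
    proof -
      have "(LINT x:(\<Union>K\<in>D. K)|lborel. \<bar>indicator {0..T} x * g x\<bar>)
        = (\<Sum>K\<in>D. (LINT x:K|lborel. \<bar>indicator {0..T} x * g x\<bar>))"
      proof (rule set_integral_finite_UN_AE[OF fin])
        fix K L assume KL: "K \<in> D" "L \<in> D"
        \<comment> \<open>Cells of a division may share endpoints, so they are disjoint only up to
          null sets.\<close>
        show "AE x in lborel. (x \<in> K \<and> x \<in> L) \<longrightarrow> K = L"
        proof (cases "K = L")
          case False
          have "K \<inter> L \<in> null_sets lborel"
          proof -
            have "interior K \<inter> interior L = {}" using division_ofD(5)[OF D(1)] KL False by blast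
            moreover obtain p q r s where "K = {p..q}" "L = {r..s}" using KT(4) KL by metis
            ultimately have "interior {max p r..min q s} = {}" "K \<inter> L = {max p r..min q s}"
              by (auto simp: greaterThanLessThan_empty_iff)
            thus ?thesis by (auto simp: null_sets_def emeasure_lborel_Icc_eq)
          qed
          from AE_not_in[OF this] show ?thesis by eventually_elim auto
        qed auto
      next
        fix K assume K: "K \<in> D"
        show "K \<in> sets lborel" using bor K by auto
        show "set_integrable lborel K (\<lambda>x. \<bar>indicator {0..T} x * g x\<bar>)"
          unfolding set_integrable_def using gT bor[OF K] by (intro integrable_mult_indicator) auto
      qed
      thus ?thesis by simp
    qed
    also have "\<dots> < \<epsilon>"
    proof (rule dl(2))
      show b: "\<Union>D \<in> sets lborel" using bor fin by (intro sets.finite_Union) auto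
      have lm: "\<Union>D \<in> lmeasurable" using lmeasurable_division[OF D(1)] .
      have "emeasure lborel (\<Union>D) = emeasure lebesgue (\<Union>D)" using b by simp
      also have "\<dots> = ennreal (measure lebesgue (\<Union>D))" using lm by (simp add: emeasure_eq_measure2)
      also have "\<dots> < ennreal \<delta>" using D(3) dl(1)
        by (simp add: division_of_total_length[OF D(1), symmetric] ennreal_lessI)
      finally show "emeasure lborel (\<Union>D) < ennreal \<delta>" .
    qed
    finally show "(\<Sum>K\<in>D. \<bar>f (Sup K) - f (Inf K)\<bar>) < \<epsilon>" .
  qed
qed

section \<open>Caputo derivatives\<close>

lemma caputo_order_eq: "real k < \<alpha> \<Longrightarrow> \<alpha> \<le> real k + 1 \<Longrightarrow> caputo_order \<alpha> = Suc k"
  unfolding caputo_order_def by (subst ceiling_unique[of "int (Suc k)"]) auto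

lemma caputo_class_unit:
  assumes "0 < \<beta>" "\<beta> \<le> 1"
  shows "f \<in> caputo_class \<beta> \<longleftrightarrow> (\<forall>T>0. abs_continuous_on 0 T f)"
  using caputo_order_eq[of 0 \<beta>] assms by (simp add: caputo_class_def)

text \<open>Lowering the order and its ceiling by the same \<open>k\<close> leaves the kernel
  exponent unchanged, and the same derivative of \<open>x\<close> stands under the integral. All
  later analysis can thus stay with orders in \<open>(0, 1]\<close>.\<close>

lemma caputo_hderiv:
  assumes "real k < \<alpha>" "\<alpha> \<le> real k + 1"
  shows "caputo \<alpha> x t = caputo (\<alpha> - real k) (hderiv k x) t"
    "caputo_exists \<alpha> x t = caputo_exists (\<alpha> - real k) (hderiv k x) t"
proof -
  have 1: "caputo_order \<alpha> = Suc k" "caputo_order (\<alpha> - real k) = Suc 0"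
    using assms by (auto intro: caputo_order_eq)
  have 2: "\<alpha> = real (Suc k) \<longleftrightarrow> \<alpha> - real k = real (Suc 0)" by auto
  have 3: "real (Suc k) - \<alpha> = real (Suc 0) - (\<alpha> - real k)" by simp
  have 4: "hderiv (Suc k) x = hderiv (Suc 0) (hderiv k x)" using hderiv_one[of k x] by simp
  show "caputo \<alpha> x t = caputo (\<alpha> - real k) (hderiv k x) t"
    unfolding caputo_def 1 Let_def 2 3 4 ..
  show "caputo_exists \<alpha> x t = caputo_exists (\<alpha> - real k) (hderiv k x) t"
    unfolding caputo_exists_def 1 Let_def 2 3 4 by simp
qed

lemma caputo_cong:
  assumes "\<And>t. t \<ge> 0 \<Longrightarrow> f t = g t" "t \<ge> 0"
  shows "caputo \<beta> f t = caputo \<beta> g t" "caputo_exists \<beta> f t = caputo_exists \<beta> g t"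
proof -
  have eq: "(\<lambda>\<tau>. indicat_real {0..t} \<tau> *\<^sub>R ((t - \<tau>) powr p * hderiv n f \<tau>)) =
      (\<lambda>\<tau>. indicator {0..t} \<tau> *\<^sub>R ((t - \<tau>) powr p * hderiv n g \<tau>))" for n p
  proof
    fix \<tau>
    show "indicat_real {0..t} \<tau> *\<^sub>R ((t - \<tau>) powr p * hderiv n f \<tau>) =
      indicator {0..t} \<tau> *\<^sub>R ((t - \<tau>) powr p * hderiv n g \<tau>)"
      using hderiv_cong[of f g \<tau> n] assms(1) by (cases "\<tau> \<in> {0..t}") auto
  qed
  have h: "hderiv n f t = hderiv n g t" for n using hderiv_cong[of f g t n] assms by simp
  show "caputo \<beta> f t = caputo \<beta> g t"
    unfolding caputo_def Let_def set_lebesgue_integral_def eq h ..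
  have "(hderiv n f differentiable (at t within {0..}))
    = (hderiv n g differentiable (at t within {0..}))" for n
  proof -
    have "hderiv n f s = hderiv n g s" if "s \<in> {0..}" for s
      using hderiv_cong[of f g s n] assms(1) that by simp
    thus ?thesis using differentiable_transform_within[of _ t "{0..}" 1] assms(2) 
      by (metis atLeast_iff zero_less_one)
  qed
  thus "caputo_exists \<beta> f t = caputo_exists \<beta> g t"
    unfolding caputo_exists_def Let_def set_integrable_def eq by simp
qed

text \<open>Up to the factor \<open>Gamma (1 - \<beta>)\<close> the two integrands agree off a null
  set: the exceptional points of \<open>AE_hderiv_density\<close> together with
  \<open>\<tau> = 0\<close>, where that lemma is silent but the interval \<open>{0..t}\<close> may
  have its endpoint.\<close>

lemma caputo_eq_rl_integral:
  assumes d: "has_density f g" and \<beta>: "0 < \<beta>" "\<beta> < 1"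
  shows "caputo \<beta> f t = rl_integral (1 - \<beta>) g t"
    "caputo_exists \<beta> f t \<longleftrightarrow> integrable lborel (\<lambda>\<tau>. rl_kernel (1 - \<beta>) (t - \<tau>) * g \<tau>)"
proof -
  have g: "causal_L1 g" using d by (simp add: has_density_def)
  have [measurable]: "g \<in> borel_measurable borel" using g by (rule causal_L1_measurable)
  have ord: "caputo_order \<beta> = 1" using caputo_order_eq[of 0 \<beta>] \<beta> by simp
  define I where "I \<tau> = indicator {0..t} \<tau> *\<^sub>R ((t - \<tau>) powr (1 - \<beta> - 1) * hderiv 1 f \<tau>)" for \<tau>
  define J where "J \<tau> = Gamma (1 - \<beta>) * (rl_kernel (1 - \<beta>) (t - \<tau>) * g \<tau>)" for \<tau>
  have G: "Gamma (1 - \<beta>) \<noteq> 0" using Gamma_real_pos[of "1 - \<beta>"] \<beta> by linarith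
  have "AE \<tau> in lebesgue. \<tau> \<noteq> 0" by (rule AE_completion) (rule AE_lborel_singleton)
  with AE_hderiv_density[OF d] have ae: "AE \<tau> in lebesgue. J \<tau> = I \<tau>"
  proof eventually_elim
    case (elim \<tau>)
    consider "\<tau> < 0" | "\<tau> \<ge> t" "\<tau> > 0" | "0 < \<tau>" "\<tau> < t" using elim(2) by linarith
    thus ?case
    proof cases
      case 1 thus ?thesis using g by (simp add: I_def J_def causal_L1_def)
    next
      case 2 thus ?thesis by (cases "\<tau> = t") (auto simp: I_def J_def rl_kernel_def)
    next
      case 3 thus ?thesis using elim(1) G by (simp add: I_def J_def rl_kernel_def)
    qed
  qed
  have J: "J \<in> borel_measurable lborel" unfolding J_def by measurable
  have J': "J \<in> borel_measurable lebesgue" using J by (rule measurable_completion)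
  \<comment> \<open>Measurability passes from the Borel function \<open>J\<close> to
    \<open>I\<close> by completeness of Lebesgue measure; this is how the a.e. derivative becomes
    measurable.\<close>
  have I: "I \<in> borel_measurable lebesgue" using borel_measurable_AE[OF J' ae] .
  have "integral\<^sup>L lebesgue I = integral\<^sup>L lebesgue J"
    using ae by (intro integral_cong_AE I J') (auto elim: eventually_mono)
  also have "\<dots> = Gamma (1 - \<beta>) * rl_integral (1 - \<beta>) g t"
    unfolding integral_completion[OF J] unfolding J_def[abs_def] by (simp add: rl_integral_def)
  finally show "caputo \<beta> f t = rl_integral (1 - \<beta>) g t"
    using \<beta> G unfolding I_def[abs_def] by (simp add: caputo_def ord set_lebesgue_integral_def)
  have "caputo_exists \<beta> f t \<longleftrightarrow> integrable lebesgue I"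
    using \<beta> unfolding I_def[abs_def] by (simp add: caputo_exists_def ord set_integrable_def)
  also have "\<dots> \<longleftrightarrow> integrable lebesgue J"
    using ae by (intro integrable_cong_AE I J') (auto elim: eventually_mono)
  also have "\<dots> \<longleftrightarrow> integrable lborel (\<lambda>\<tau>. rl_kernel (1 - \<beta>) (t - \<tau>) * g \<tau>)"
    unfolding integrable_completion[OF J] unfolding J_def[abs_def] using G by simp
  finally show "caputo_exists \<beta> f t \<longleftrightarrow> integrable lborel (\<lambda>\<tau>. rl_kernel (1 - \<beta>) (t - \<tau>) * g \<tau>)" .
qed

section \<open>Composing and inverting Caputo derivatives\<close>

lemma has_densityD:
  assumes "has_density f g"
  shows "causal_L1 g" "t \<ge> 0 \<Longrightarrow> f t = f 0 + rl_integral 1 g t"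
proof -
  show g: "causal_L1 g" using assms unfolding has_density_def by blast
  show "f t = f 0 + rl_integral 1 g t" if "t \<ge> 0"
  proof -
    have "f t = f 0 + (LINT \<tau>:{0..t}|lborel. g \<tau>)" using assms that unfolding has_density_def
      by blast
    moreover have "rl_integral 1 g t = (LINT \<tau>:{0..t}|lborel. g \<tau>)"
      using g by (intro rl_integral_one) (auto simp: causal_L1_def)
    ultimately show ?thesis by simp
  qed
qed

lemma has_densityI:
  assumes g: "causal_L1 g" and f: "\<And>t. t \<ge> 0 \<Longrightarrow> f t = f 0 + rl_integral 1 g t"
  shows "has_density f g"
proof -
  have "f t = f 0 + (LINT \<tau>:{0..t}|lborel. g \<tau>)" if "t \<ge> 0" for t
  proof -
    have "rl_integral 1 g t = (LINT \<tau>:{0..t}|lborel. g \<tau>)"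
      using g by (intro rl_integral_one) (auto simp: causal_L1_def)
    thus ?thesis using f[OF that] by simp
  qed
  thus ?thesis unfolding has_density_def using g by blast
qed

lemma abs_continuous_has_density:
  assumes ac: "\<And>T. T > 0 \<Longrightarrow> abs_continuous_on 0 T f"
  obtains g where "has_density f g"
proof -
  obtain g where [measurable]: "g \<in> borel_measurable borel" and gi:
    "\<And>t. set_integrable lborel {0..t} g"
    and f: "\<And>t. 0 \<le> t \<Longrightarrow> f t = f 0 + (LINT \<tau>:{0..t}|lborel. g \<tau>)"
    using abs_continuous_density[OF ac] by blast
  define h where "h \<tau> = (if \<tau> > 0 then g \<tau> else 0)" for \<tau>
  have [measurable]: "h \<in> borel_measurable borel" unfolding h_def by measurable
  have ae: "AE \<tau> in lborel. indicator {0..t} \<tau> *\<^sub>R g \<tau> = indicator {0..t} \<tau> *\<^sub>R h \<tau>" for t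
    using AE_lborel_singleton[of 0] by eventually_elim (auto simp: h_def indicator_def)
  have "set_integrable lborel {0..t} h" for t
    using gi[of t] integrable_cong_AE[OF _ _ ae[of t]] by (simp add: set_integrable_def)
  hence "causal_L1 h" by (auto simp: causal_L1_def h_def)
  moreover have "f t = f 0 + (LINT \<tau>:{0..t}|lborel. h \<tau>)" if "t \<ge> 0" for t
  proof -
    have "(LINT \<tau>:{0..t}|lborel. g \<tau>) = (LINT \<tau>:{0..t}|lborel. h \<tau>)"
      unfolding set_lebesgue_integral_def by (intro integral_cong_AE ae) auto
    thus ?thesis using f[OF that] by simp
  qed
  ultimately have "has_density f h" unfolding has_density_def by blast
  thus ?thesis using that by blast
qed

text \<open>The hypothesis on \<open>hderiv 1 f\<close> does not assert differentiability, as an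
  undefined derivative also denotes a number. Absolute continuity closes the gap: a density
  \<open>g\<close> exists and equals \<open>hderiv 1 f\<close>, hence \<open>\<phi>\<close>, almost
  everywhere.\<close>

lemma has_density_restrict_pos:
  assumes ac: "\<And>T. T > 0 \<Longrightarrow> abs_continuous_on 0 T f"
    and \<phi>: "continuous_on {0..} \<phi>" and eq: "\<And>t. t > 0 \<Longrightarrow> hderiv 1 f t = \<phi> t"
  shows "has_density f (restrict_pos \<phi>)"
proof -
  obtain g where d: "has_density f g" using abs_continuous_has_density[OF ac] by blast
  have g: "causal_L1 g" using d by (rule has_densityD)
  have [measurable]: "g \<in> borel_measurable borel" "restrict_pos \<phi> \<in> borel_measurable borel"
    using causal_L1_measurable[OF g] restrict_pos_measurable[OF \<phi>] by auto
  have "AE t in lebesgue. g t = restrict_pos \<phi> t"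
    using AE_hderiv_density[OF d]
    by eventually_elim (use g eq in \<open>force simp: restrict_pos_def causal_L1_def\<close>)
  hence ae: "AE t in lborel. g t = restrict_pos \<phi> t" by (simp add: AE_completion_iff)
  have "AE \<tau> in lborel. rl_kernel 1 (t - \<tau>) * g \<tau> = rl_kernel 1 (t - \<tau>) * restrict_pos \<phi> \<tau>" for t
    using ae by eventually_elim simp
  hence "rl_integral 1 g t = rl_integral 1 (restrict_pos \<phi>) t" for t
    unfolding rl_integral_def by (intro integral_cong_AE) auto
  moreover have "set_integrable lborel {0..t} (restrict_pos \<phi>)" for t
    using integrable_rl_kernel_continuous[OF \<phi>, of 1 t] integrable_rl_kernel_one_iff[of
      "restrict_pos \<phi>" t]
    by (auto simp: restrict_pos_def)
  hence causal: "causal_L1 (restrict_pos \<phi>)" by (auto simp: causal_L1_def restrict_pos_def)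
  ultimately have "f t = f 0 + rl_integral 1 (restrict_pos \<phi>) t" if "t \<ge> 0" for t
    using has_densityD(2)[OF d that] by simp
  thus ?thesis by (rule has_densityI[OF causal])
qed

text \<open>On positive arguments \<open>\<phi>\<close> is a constant plus an indefinite integral.
  Integrating to order \<open>\<gamma> = 1 - \<beta>\<close> and exchanging the orders
  \<open>\<gamma>\<close> and 1 through \<open>1 + \<gamma>\<close> exhibits
  \<open>caputo \<beta> f\<close> as the indefinite integral of a density \<open>h\<close>.
  Integrating \<open>h\<close> to order \<open>\<beta>\<close> restores \<open>\<phi>\<close>, since
  \<open>\<beta> + \<gamma> = 1\<close>.\<close>

lemma caputo_complement:
  assumes f: "has_density f (restrict_pos \<phi>)" and \<phi>: "has_density \<phi> g" and \<beta>: "0 < \<beta>" "\<beta> < 1"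
  shows "caputo \<beta> f 0 = 0" "T > 0 \<Longrightarrow> abs_continuous_on 0 T (caputo \<beta> f)"
    "t > 0 \<Longrightarrow> caputo (1 - \<beta>) (caputo \<beta> f) t = \<phi> t" "caputo_exists (1 - \<beta>) (caputo \<beta> f) t"
proof -
  define \<gamma> where "\<gamma> = 1 - \<beta>"
  have \<gamma>: "0 < \<gamma>" "\<gamma> < 1" using \<beta> by (auto simp: \<gamma>_def)
  have g: "causal_L1 g" using \<phi> by (rule has_densityD)
  note g' = causal_L1_rl_integral[OF g]
  \<comment> \<open>The formal derivative of the order-\<open>\<gamma>\<close> integral of
    \<open>\<phi>\<close>. The jump of the cut function at 0 produces the kernel term, unbounded
    near 0 but integrable.\<close>
  define h where "h s = \<phi> 0 * rl_kernel \<gamma> s + rl_integral \<gamma> g s" for s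
  have h: "causal_L1 h" unfolding h_def by (intro causal_L1_lincomb causal_L1_rl_kernel g' \<gamma>)
  have r: "restrict_pos \<phi> = (\<lambda>s. \<phi> 0 * rl_kernel 1 s + rl_integral 1 g s)"
  proof
    fix s
    show "restrict_pos \<phi> s = \<phi> 0 * rl_kernel 1 s + rl_integral 1 g s"
    proof (cases "s > 0")
      case True
      thus ?thesis using has_densityD(2)[OF \<phi>, of s] by (simp add: restrict_pos_def rl_kernel_one)
    next
      case False
      thus ?thesis using g'[of 1] by (simp add: restrict_pos_def rl_kernel_one causal_L1_def)
    qed
  qed
  have y: "caputo \<beta> f = rl_integral \<gamma> (restrict_pos \<phi>)"
    using caputo_eq_rl_integral(1)[OF f \<beta>] by (auto simp: \<gamma>_def)
  have y_eq: "caputo \<beta> f t = rl_integral 1 h t" for t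
  proof -
    have "caputo \<beta> f t = \<phi> 0 * rl_integral \<gamma> (rl_kernel 1) t + rl_integral \<gamma> (rl_integral 1 g) t"
      unfolding y r using \<gamma> rl_integral_semigroup(2)[OF g, of \<gamma> 1 t] rl_integral_rl_kernel(2)[of \<gamma> 1
        t]
      by (intro rl_integral_lincomb) auto
    also have "\<dots> = \<phi> 0 * rl_kernel (1 + \<gamma>) t + rl_integral (1 + \<gamma>) g t"
      using \<gamma> rl_integral_semigroup(1)[OF g, of \<gamma> 1 t] rl_integral_rl_kernel(1)[of \<gamma> 1 t]
        by (simp add: add.commute)
    also have "\<dots> = \<phi> 0 * rl_integral 1 (rl_kernel \<gamma>) t + rl_integral 1 (rl_integral \<gamma> g) t"
      using \<gamma> rl_integral_semigroup(1)[OF g, of 1 \<gamma> t] rl_integral_rl_kernel(1)[of 1 \<gamma> t] by simp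
    also have "\<dots> = rl_integral 1 h t"
      unfolding h_def using \<gamma> rl_integral_semigroup(2)[OF g, of 1 \<gamma> t] rl_integral_rl_kernel(2)[of 1
        \<gamma> t]
      by (intro rl_integral_lincomb(1)[symmetric]) auto
    finally show ?thesis .
  qed
  show y0: "caputo \<beta> f 0 = 0"
    unfolding y_eq using h by (intro rl_integral_nonpos) (auto simp: causal_L1_def)
  have d: "has_density (caputo \<beta> f) h" using y_eq y0 by (intro has_densityI[OF h]) auto
  show "T > 0 \<Longrightarrow> abs_continuous_on 0 T (caputo \<beta> f)" using abs_continuous_on_density[OF d] .
  have bg: "\<beta> + \<gamma> = 1" by (simp add: \<gamma>_def)
  have lin: "rl_integral \<beta> h t = \<phi> 0 * rl_kernel 1 t + rl_integral 1 g t"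
    "integrable lborel (\<lambda>\<tau>. rl_kernel \<beta> (t - \<tau>) * h \<tau>)" for t
    using rl_integral_lincomb[OF rl_integral_rl_kernel(2)[OF \<beta>(1) \<gamma>(1), of t]
      rl_integral_semigroup(2)[OF g \<beta>(1) \<gamma>(1), of t]]
      rl_integral_rl_kernel(1)[OF \<beta>(1) \<gamma>(1), of t] rl_integral_semigroup(1)[OF g \<beta>(1) \<gamma>(1), of t] bg
    unfolding h_def[abs_def] by simp_all
  have g\<beta>: "1 - \<gamma> = \<beta>" by (simp add: \<gamma>_def)
  show "caputo_exists (1 - \<beta>) (caputo \<beta> f) t"
    using caputo_eq_rl_integral(2)[OF d \<gamma>, of t] lin(2) unfolding g\<beta> unfolding \<gamma>_def by simp
  show "caputo (1 - \<beta>) (caputo \<beta> f) t = \<phi> t" if "t > 0"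
    using caputo_eq_rl_integral(1)[OF d \<gamma>, of t] lin(1)[of t] has_densityD(2)[OF \<phi>, of t] that
    unfolding g\<beta> unfolding \<gamma>_def by (simp add: rl_kernel_one)
qed

text \<open>For \<open>\<beta> < 1\<close> the hypothesis says that \<open>\<phi>\<close> is the
  order \<open>1 - \<beta>\<close> integral of the density of \<open>f\<close>; integrating to order
  \<open>\<beta>\<close> gives the plain integral of that density. For \<open>\<beta> = 1\<close>,
  \<open>\<phi>\<close> itself is a density.\<close>

lemma caputo_inverse:
  assumes f: "f \<in> caputo_class \<beta>" and \<beta>: "0 < \<beta>" "\<beta> \<le> 1"
    and \<phi>: "continuous_on {0..} \<phi>"
    and eq: "\<And>t. t > 0 \<Longrightarrow> caputo \<beta> f t = \<phi> t"
    and t: "t \<ge> 0"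
  shows "f t = f 0 + rl_integral \<beta> (restrict_pos \<phi>) t"
proof -
  have ac: "\<And>T. T > 0 \<Longrightarrow> abs_continuous_on 0 T f" using f caputo_class_unit[OF \<beta>] by blast
  show ?thesis
  proof (cases "\<beta> = 1")
    case True
    have "caputo_order 1 = 1" using caputo_order_eq[of 0 1] by simp
    hence "hderiv 1 f t = \<phi> t" if "t > 0" for t using eq[OF that] True by (simp add: caputo_def)
    from has_densityD(2)[OF has_density_restrict_pos[OF ac \<phi> this] t] show ?thesis using True
      by simp
  next
    case False
    hence \<beta>1: "\<beta> < 1" using \<beta> by simp
    obtain g where d: "has_density f g" using abs_continuous_has_density[OF ac] by blast
    have g: "causal_L1 g" using d by (rule has_densityD)
    have "restrict_pos \<phi> = rl_integral (1 - \<beta>) g"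
    proof
      fix s
      show "restrict_pos \<phi> s = rl_integral (1 - \<beta>) g s"
        using caputo_eq_rl_integral(1)[OF d \<beta>(1) \<beta>1, of s] eq[of s] causal_L1_rl_integral[OF g, of
          "1 - \<beta>"] \<beta>1
        by (cases "s > 0") (auto simp: restrict_pos_def causal_L1_def)
    qed
    hence "rl_integral \<beta> (restrict_pos \<phi>) t = rl_integral 1 g t"
      using rl_integral_semigroup(1)[OF g, of \<beta> "1 - \<beta>" t] \<beta> \<beta>1 by simp
    thus ?thesis using has_densityD(2)[OF d t] by simp
  qed
qed

lemma has_vector_derivative_rl_integral_one:
  assumes \<phi>: "continuous_on {0..} \<phi>" and f: "\<And>t. t \<ge> 0
    \<Longrightarrow> f t = c + rl_integral 1 (restrict_pos \<phi>) t" and t: "t \<ge> 0"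
  shows "(f has_vector_derivative \<phi> t) (at t within {0..})"
proof -
  have [measurable]: "restrict_pos \<phi> \<in> borel_measurable borel"
    by (rule restrict_pos_measurable[OF \<phi>])
  have si: "set_integrable lborel {0..s} (restrict_pos \<phi>)" for s
    using integrable_rl_kernel_continuous[OF \<phi>, of 1 s] integrable_rl_kernel_one_iff[of
      "restrict_pos \<phi>" s]
    by (auto simp: restrict_pos_def)
  have eq: "f s = c + integral {0..s} \<phi>" if "s \<ge> 0" for s
  proof -
    have "rl_integral 1 (restrict_pos \<phi>) s = integral {0..s} (restrict_pos \<phi>)"
      using rl_integral_one[of "restrict_pos \<phi>" s] set_borel_integral_eq_integral(2)[OF si, of s]
        by (simp add: restrict_pos_def)
    also have "\<dots> = integral {0..s} \<phi>"
      by (rule integral_spike[of "{0}"]) (auto simp: restrict_pos_def)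
    finally show ?thesis using f[OF that] by simp
  qed
  have "((\<lambda>u. integral {0..u} \<phi>) has_vector_derivative \<phi> t) (at t within {0..t + 1})"
    using t by (intro integral_has_vector_derivative continuous_on_subset[OF \<phi>]) auto
  moreover have "at t within {0..t + 1} = at t within {0..}"
    by (rule at_within_nhd[of _ "{..<t + 1}"]) auto
  ultimately have "((\<lambda>u. c + integral {0..u} \<phi>) has_vector_derivative \<phi> t) (at t within {0..})"
    by (auto intro!: derivative_eq_intros)
  thus ?thesis
    by (rule has_vector_derivative_transform[rotated 2]) (use t in simp, rule eq, simp)
qed

section \<open>The equation and the system\<close>

lemma solves_system_continuous:
  assumes "solves_system m a \<beta> C x y" "\<forall>k\<le>2 * m - 2. 0 < \<beta> k \<and> \<beta> k \<le> 1" "j \<le> 2 * m - 2"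
  shows "continuous_on {0..} (y j)"
  using assms caputo_class_unit
    by (intro abs_continuous_on_imp_continuous_on) (auto simp: solves_system_def)

text \<open>The system leaves no choice of components: every even one must be an integer derivative
  of \<open>x\<close> and every odd one the Caputo derivative of its predecessor, which is
  \<open>caputo (\<alpha> k) x\<close> with its order split. Solving (E) for its leading term then
  gives the last equation.\<close>

lemma solves_multiterm_imp_system:
  fixes m :: nat and a \<alpha> \<beta> :: "nat \<Rightarrow> real"
  assumes m: "m \<ge> 1"
    and am: "a m \<noteq> 0"
    and \<alpha>: "\<forall>k\<in>{1..m}. real k - 1 < \<alpha> k \<and> \<alpha> k \<le> real k"
    and \<beta>even: "\<forall>j<m. \<beta> (2 * j) = \<alpha> (j + 1) - real j"
    and \<beta>odd: "\<forall>j<m - 1. \<beta> (2 * j + 1) = real (j + 1) - \<alpha> (j + 1)"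
    and \<beta>: "\<forall>k\<le>2 * m - 2. 0 < \<beta> k \<and> \<beta> k \<le> 1"
    and sol: "solves_multiterm m a \<alpha> C x"
  shows "\<exists>y. solves_system m a \<beta> C x y \<and> y 0 = x"
proof -
  have \<alpha>': "real k < \<alpha> (Suc k)" "\<alpha> (Suc k) \<le> real k + 1" if "k < m" for k
    using \<alpha>[rule_format, of "Suc k"] that by auto
  have cl: "x \<in> caputo_class (\<alpha> k)" if "k \<in> {1..m}" for k
    using sol that by (auto simp: solves_multiterm_def)
  have ex: "caputo_exists (\<alpha> k) x t" if "k \<in> {1..m}" "t > 0" for k t
    using sol that by (auto simp: solves_multiterm_def)
  have eqn: "a 0 * x t + (\<Sum>k=1..m. a k * caputo (\<alpha> k) x t) = 0" if "t > 0" for t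
    using sol that by (auto simp: solves_multiterm_def)
  have init: "hderiv i x 0 = C i" if "i < m" for i
    using sol that by (auto simp: solves_multiterm_def)
  \<comment> \<open>\<open>hderiv i x\<close> is the top derivative that the class for
    \<open>\<alpha> (Suc i)\<close> controls; running through all orders covers every
    \<open>i < m\<close>.\<close>
  have ac: "abs_continuous_on 0 T (hderiv i x)" if "i < m" "T > 0" for i T
  proof -
    have "caputo_order (\<alpha> (Suc i)) = Suc i" using caputo_order_eq \<alpha>'[OF that(1)] by blast
    thus ?thesis using cl[of "Suc i"] that by (simp add: caputo_class_def)
  qed
  have cont: "continuous_on {0..} (hderiv i x)" if "i < m" for i
    using ac[OF that] by (rule abs_continuous_on_imp_continuous_on)
  have red: "caputo (\<alpha> (Suc i)) x t = caputo (\<beta> (2 * i)) (hderiv i x) t"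
    "caputo_exists (\<alpha> (Suc i)) x t = caputo_exists (\<beta> (2 * i)) (hderiv i x) t" if "i < m" for i t
    using caputo_hderiv[OF \<alpha>'[OF that]] \<beta>even that by auto
  have dens: "has_density (hderiv i x) (restrict_pos (hderiv (Suc i) x))" if "Suc i < m" for i
    using that ac[of i] cont[of "Suc i"]
      by (intro has_density_restrict_pos) (auto simp: hderiv_one[simplified])
  have compl: "caputo (\<beta> (2 * i)) (hderiv i x) 0 = 0"
    "T > 0 \<Longrightarrow> abs_continuous_on 0 T (caputo (\<beta> (2 * i)) (hderiv i x))"
    "t > 0 \<Longrightarrow> caputo (\<beta> (2 * i + 1)) (caputo (\<beta> (2 * i)) (hderiv i x)) t = hderiv (Suc i) x t"
    "caputo_exists (\<beta> (2 * i + 1)) (caputo (\<beta> (2 * i)) (hderiv i x)) t" if i: "Suc i < m" for i t T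
  proof -
    obtain g where g: "has_density (hderiv (Suc i) x) g"
      using abs_continuous_has_density[OF ac[OF i]] by blast
    have 1: "\<beta> (2 * i + 1) = 1 - \<beta> (2 * i)" using \<beta>even \<beta>odd i by auto
    have 2: "0 < \<beta> (2 * i)" using \<beta> i by auto
    \<comment> \<open>An odd order follows this even one, and its positivity excludes the even order
      1. Hence the complement lemma, stated for orders strictly between 0 and 1, applies.\<close>
    have "0 < \<beta> (2 * i + 1)" using \<beta>[rule_format, of "2 * i + 1"] i by auto
    hence 3: "\<beta> (2 * i) < 1" using 1 by simp
    note c = caputo_complement[OF dens[OF i] g 2 3]
    show "caputo (\<beta> (2 * i)) (hderiv i x) 0 = 0" by (rule c(1))
    show "T > 0 \<Longrightarrow> abs_continuous_on 0 T (caputo (\<beta> (2 * i)) (hderiv i x))" by (rule c(2))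
    show "t > 0 \<Longrightarrow> caputo (\<beta> (2 * i + 1)) (caputo (\<beta> (2 * i)) (hderiv i x)) t = hderiv (Suc i) x t"
      unfolding 1 by (rule c(3))
    show "caputo_exists (\<beta> (2 * i + 1)) (caputo (\<beta> (2 * i)) (hderiv i x)) t" unfolding 1
      by (rule c(4))
  qed
  \<comment> \<open>For odd \<open>j = 2 * i + 1\<close> the order is that of the preceding
    equation, with index \<open>j - 1 = 2 * i\<close>, and \<open>j div 2 = i\<close>.\<close>
  define y where "y j = (if even j then hderiv (j div 2) x else caputo (\<beta> (j - 1)) (hderiv
    (j div 2) x))" for j
  have y_even: "y (2 * i) = hderiv i x" for i by (simp add: y_def)
  have y_odd: "y (2 * i + 1) = caputo (\<beta> (2 * i)) (hderiv i x)" for i by (simp add: y_def)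
  have y0: "y 0 = x" using y_even[of 0] by simp
  have "solves_system m a \<beta> C x y"
    unfolding solves_system_def
  proof (intro conjI allI impI ballI)
    fix j assume j: "j \<le> 2 * m - 2"
    show "y j \<in> caputo_class (\<beta> j)"
    proof (cases "even j")
      case True
      then obtain i where i: "j = 2 * i" by (elim evenE)
      have "i < m" using i j m by linarith
      thus ?thesis using ac \<beta> j caputo_class_unit[of "\<beta> j"] y_even[of i] unfolding i by auto
    next
      case False
      then obtain i where i: "j = 2 * i + 1" by (elim oddE)
      have "Suc i < m" using i j m by linarith
      thus ?thesis using compl(2) \<beta> j caputo_class_unit[of "\<beta> j"] y_odd[of i] unfolding i by auto
    qed
  next
    fix t :: real show "x t = y 0 t" using y0 by simp
  next
    fix j and t :: real assume j: "j < 2 * m - 2" and t: "0 < t"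
    have "caputo_exists (\<beta> j) (y j) t \<and> caputo (\<beta> j) (y j) t = y (j + 1) t"
    proof (cases "even j")
      case True
      then obtain i where i: "j = 2 * i" by (elim evenE)
      have "i < m" using i j m by linarith
      thus ?thesis using red(2)[of i t] ex[of "Suc i" t] t unfolding i y_even y_odd by auto
    next
      case False
      then obtain i where i: "j = 2 * i + 1" by (elim oddE)
      have im: "Suc i < m" using i j m by linarith
      have "y (j + 1) = hderiv (Suc i) x" using y_even[of "Suc i"] i by simp
      thus ?thesis using compl(3)[OF im t] compl(4)[OF im] unfolding i y_odd by simp
    qed
    thus "caputo_exists (\<beta> j) (y j) t" "caputo (\<beta> j) (y j) t = y (j + 1) t" by auto
  next
    fix t :: real assume t: "0 < t"
    have last: "2 * m - 2 = 2 * (m - 1)" "Suc (m - 1) = m" "m - 1 < m" using m by auto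
    show "caputo_exists (\<beta> (2 * m - 2)) (y (2 * m - 2)) t"
      using red(2)[of "m - 1" t] ex[of m t] m t unfolding last(1) y_even last(2) by auto
    have "caputo (\<beta> (2 * m - 2)) (y (2 * m - 2)) t = caputo (\<alpha> m) x t"
      using red(1)[of "m - 1" t] m unfolding last(1) y_even last(2) by auto
    also have "\<dots> = - 1 / a m * (a 0 * x t + (\<Sum>k=1..m - 1. a k * caputo (\<alpha> k) x t))"
    proof -
      have "{1..m} = insert m {1..m - 1}" using m by auto
      hence "(\<Sum>k=1..m. a k * caputo (\<alpha> k) x t)
        = a m * caputo (\<alpha> m) x t + (\<Sum>k=1..m - 1. a k * caputo (\<alpha> k) x t)"
        using m by simp
      thus ?thesis using eqn[OF t] am by (simp add: field_simps)
    qed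
    also have "(\<Sum>k=1..m - 1. a k * caputo (\<alpha> k) x t) = (\<Sum>k=1..m - 1. a k * y (2 * k - 1) t)"
    proof (rule sum.cong[OF refl])
      fix k assume k: "k \<in> {1..m - 1}"
      then obtain i where i: "k = Suc i" "i < m" by (cases k) auto
      have "2 * k - 1 = 2 * i + 1" using i by simp
      thus "a k * caputo (\<alpha> k) x t = a k * y (2 * k - 1) t"
        using red(1)[OF i(2), of t] y_odd[of i] i by simp
    qed
    finally show "caputo (\<beta> (2 * m - 2)) (y (2 * m - 2)) t =
        - 1 / a m * (a 0 * x t + (\<Sum>k=1..m - 1. a k * y (2 * k - 1) t))" .
  next
    show "y 0 0 = C 0" using init[of 0] m y0 by simp
  next
    fix i assume i: "i \<in> {1..m - 1}"
    show "y (2 * i) 0 = C i" using init[of i] i y_even[of i] m by auto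
    obtain i' where i': "i = Suc i'" "Suc i' < m" using i m by (cases i) auto
    have "2 * i - 1 = 2 * i' + 1" using i' by simp
    thus "y (2 * i - 1) 0 = 0" using compl(1)[OF i'(2)] y_odd[of i'] by simp
  qed
  thus ?thesis using y0 by blast
qed

lemma solves_system_imp_multiterm:
  fixes m :: nat and a \<alpha> \<beta> :: "nat \<Rightarrow> real"
  assumes m: "m \<ge> 1"
    and am: "a m \<noteq> 0"
    and \<alpha>: "\<forall>k\<in>{1..m}. real k - 1 < \<alpha> k \<and> \<alpha> k \<le> real k"
    and \<beta>even: "\<forall>j<m. \<beta> (2 * j) = \<alpha> (j + 1) - real j"
    and \<beta>odd: "\<forall>j<m - 1. \<beta> (2 * j + 1) = real (j + 1) - \<alpha> (j + 1)"
    and \<beta>: "\<forall>k\<le>2 * m - 2. 0 < \<beta> k \<and> \<beta> k \<le> 1"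
    and sol: "solves_system m a \<beta> C x y"
  shows "solves_multiterm m a \<alpha> C x"
proof -
  have \<alpha>': "real k < \<alpha> (Suc k)" "\<alpha> (Suc k) \<le> real k + 1" if "k < m" for k
    using \<alpha>[rule_format, of "Suc k"] that by auto
  have cl: "y j \<in> caputo_class (\<beta> j)" if "j \<le> 2 * m - 2" for j
    using sol that by (auto simp: solves_system_def)
  have step: "caputo_exists (\<beta> j) (y j) t" "caputo (\<beta> j) (y j) t = y (j + 1) t"
    if "j < 2 * m - 2" "t > 0" for j t
    using sol that by (auto simp: solves_system_def)
  have last: "caputo_exists (\<beta> (2 * m - 2)) (y (2 * m - 2)) t"
    "caputo (\<beta> (2 * m - 2)) (y (2 * m - 2)) t
      = - 1 / a m * (a 0 * x t + (\<Sum>k=1..m - 1. a k * y (2 * k - 1) t))"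
    if "t > 0" for t
    using sol that unfolding solves_system_def by blast+
  have xy: "x t = y 0 t" if "t \<ge> 0" for t using sol that unfolding solves_system_def by blast
  have init: "y (2 * i) 0 = C i" if "i < m" for i
    using sol that unfolding solves_system_def by (cases "i = 0") auto
  have init_odd: "y (2 * i + 1) 0 = 0" if "Suc i < m" for i
    using sol that unfolding solves_system_def by (auto dest!: bspec[of _ _ "Suc i"])
  have cont: "continuous_on {0..} (y j)" if "j \<le> 2 * m - 2" for j
    by (rule solves_system_continuous[OF sol \<beta> that])
  have dy: "(y (2 * i) has_vector_derivative y (2 * Suc i) t) (at t within {0..})"
    if i: "Suc i < m" and t: "t \<ge> 0" for i t
  proof (rule has_vector_derivative_rl_integral_one[OF _ _ t])
    have j: "2 * Suc i \<le> 2 * m - 2" "2 * i + 1 \<le> 2 * m - 2" "2 * i \<le> 2 * m - 2"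
      "2 * i + 1 < 2 * m - 2" "2 * i < 2 * m - 2" using i by auto
    show c: "continuous_on {0..} (y (2 * Suc i))" using cont[OF j(1)] .
    have b: "0 < \<beta> (2 * i)" "\<beta> (2 * i) \<le> 1" "0 < \<beta> (2 * i + 1)" "\<beta> (2 * i + 1) \<le> 1"
      using \<beta> j(2,3) by blast+
    have b1: "\<beta> (2 * i) + \<beta> (2 * i + 1) = 1" using \<beta>even \<beta>odd i by auto
    let ?r = "restrict_pos (y (2 * Suc i))"
    have [measurable]: "?r \<in> borel_measurable borel" by (rule restrict_pos_measurable[OF c])
    \<comment> \<open>A nonzero initial value here would add a multiple of
      \<open>rl_kernel (1 + \<beta> (2 * i))\<close> to \<open>y (2 * i)\<close>, which would then
      no longer be an ordinary integral of the next even component.\<close>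
    have odd: "y (2 * i + 1) t = rl_integral (\<beta> (2 * i + 1)) ?r t" if "t \<ge> 0" for t
      using caputo_inverse[OF cl[OF j(2)] b(3,4) c _ that] step(2)[OF j(4)] init_odd[OF i] by simp
    have r: "restrict_pos (y (2 * i + 1)) = rl_integral (\<beta> (2 * i + 1)) ?r"
    proof
      fix s
      show "restrict_pos (y (2 * i + 1)) s = rl_integral (\<beta> (2 * i + 1)) ?r s"
      proof (cases "s > 0")
        case True
        thus ?thesis using odd[of s] by (simp add: restrict_pos_def)
      next
        case False
        thus ?thesis using rl_integral_nonpos[of ?r s] by (simp add: restrict_pos_def)
      qed
    qed
    fix t :: real assume t: "t \<ge> 0"
    have "y (2 * i) t = y (2 * i) 0 + rl_integral (\<beta> (2 * i)) (restrict_pos (y (2 * i + 1))) t"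
      using caputo_inverse[OF cl[OF j(3)] b(1,2) cont[OF j(2)] step(2)[OF j(5)] t] .
    also have "rl_integral (\<beta> (2 * i)) (restrict_pos (y (2 * i + 1))) t = rl_integral 1 ?r t"
      unfolding r using rl_integral_rl_integral(1)[OF b(1,3), of ?r t]
        integrable_rl_kernel_continuous[OF c, of 1 t]
        restrict_pos_measurable[OF c] unfolding b1 by simp
    finally show "y (2 * i) t = y (2 * i) 0 + rl_integral 1 ?r t" .
  qed
  have hd: "hderiv i x t = y (2 * i) t" if "i < m" "t \<ge> 0" for i t
    using that
  proof (induction i arbitrary: t)
    case 0 thus ?case using xy by simp
  next
    case (Suc i)
    have "(hderiv i x has_vector_derivative y (2 * Suc i) t) (at t within {0..})"
      by (rule has_vector_derivative_transform[OF _ _ dy[OF Suc.prems]]) (use Suc in auto)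
    thus ?case using hderiv_Suc_eqI Suc.prems by blast
  qed
  have diff: "hderiv i x differentiable (at t within {0..})" if "Suc i < m" "t \<ge> 0" for i t
  proof -
    have "(hderiv i x has_vector_derivative y (2 * Suc i) t) (at t within {0..})"
      by (rule has_vector_derivative_transform[OF _ _ dy[OF that]]) (use that hd in auto)
    thus ?thesis by (rule differentiableI_vector)
  qed
  have red: "caputo (\<alpha> (Suc i)) x t = caputo (\<beta> (2 * i)) (y (2 * i)) t"
    "caputo_exists (\<alpha> (Suc i)) x t = caputo_exists (\<beta> (2 * i)) (y (2 * i)) t" if "i < m" "t \<ge> 0"
      for i t
    using caputo_hderiv[OF \<alpha>'[OF that(1)]] caputo_cong[of "hderiv i x" "y (2 * i)" t
      "\<beta> (2 * i)"] hd that \<beta>even by auto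
  have lm: "2 * m - 2 = 2 * (m - 1)" "Suc (m - 1) = m" "m - 1 < m" using m by auto
  show ?thesis unfolding solves_multiterm_def
  proof (intro conjI ballI allI impI)
    fix k assume k: "k \<in> {1..m}"
    then obtain i where i: "k = Suc i" "i < m" by (cases k) auto
    have ord: "caputo_order (\<alpha> k) = Suc i" using caputo_order_eq[OF \<alpha>'[OF i(2)]] i by simp
    have b: "0 < \<beta> (2 * i)" "\<beta> (2 * i) \<le> 1" "y (2 * i) \<in> caputo_class (\<beta> (2 * i))"
      using \<beta> cl[of "2 * i"] i by auto
    have "abs_continuous_on 0 T (hderiv i x)" if T: "T > 0" for T
    proof -
      \<comment> \<open>\<open>hderiv i x\<close> and \<open>y (2 * i)\<close> agree only on the
        half-line. A density constrains nothing else, so it carries absolute continuity from one to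
        the other.\<close>
      obtain g where g: "has_density (y (2 * i)) g"
        using abs_continuous_has_density b caputo_class_unit[OF b(1,2)] by metis
      have "hderiv i x t = hderiv i x 0 + rl_integral 1 g t" if "t \<ge> 0" for t
        using has_densityD(2)[OF g that] hd[OF i(2)] that by simp
      from has_densityI[OF has_densityD(1)[OF g] this] show ?thesis using T
        by (rule abs_continuous_on_density)
    qed
    thus "x \<in> caputo_class (\<alpha> k)" using diff i by (auto simp: caputo_class_def ord[unfolded i(1)])
  next
    fix t :: real and k assume t: "0 < t" and k: "k \<in> {1..m}"
    then obtain i where i: "k = Suc i" "i < m" by (cases k) auto
    show "caputo_exists (\<alpha> k) x t"
    proof (cases "i = m - 1")
      case True
      thus ?thesis using red(2)[OF i(2), of t] last(1)[OF t] t i unfolding lm(1) by simp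
    next
      case False
      hence "2 * i < 2 * m - 2" using i by linarith
      thus ?thesis using red(2)[OF i(2), of t] step(1)[OF _ t] t i by simp
    qed
  next
    fix t :: real assume t: "0 < t"
    have "{1..m} = insert m {1..m - 1}" using m by auto
    hence "(\<Sum>k=1..m. a k * caputo (\<alpha> k) x t)
      = a m * caputo (\<alpha> m) x t + (\<Sum>k=1..m - 1. a k * caputo (\<alpha> k) x t)"
      using m by simp
    also have "caputo (\<alpha> m) x t = - 1 / a m * (a 0 * x t + (\<Sum>k=1..m - 1. a k * y (2 * k - 1) t))"
      using red(1)[OF lm(3), of t] last(2)[OF t] t unfolding lm(2) unfolding lm(1) by simp
    also have "(\<Sum>k=1..m - 1. a k * caputo (\<alpha> k) x t) = (\<Sum>k=1..m - 1. a k * y (2 * k - 1) t)"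
    proof (rule sum.cong[OF refl])
      fix k assume k: "k \<in> {1..m - 1}"
      then obtain i where i: "k = Suc i" "i < m" "2 * i < 2 * m - 2" using m by (cases k) auto
      have "2 * k - 1 = 2 * i + 1" using i by simp
      thus "a k * caputo (\<alpha> k) x t = a k * y (2 * k - 1) t"
        using red(1)[OF i(2), of t] step(2)[OF i(3) t] i t by simp
    qed
    finally show "a 0 * x t + (\<Sum>k=1..m. a k * caputo (\<alpha> k) x t) = 0" using am by simp
  next
    fix i assume "i < m"
    thus "hderiv i x 0 = C i" using hd[of i 0] init[of i] by simp
  qed
qed

section \<open>Uniqueness for the system\<close>

definition system_rhs :: "nat \<Rightarrow> (nat \<Rightarrow> real) \<Rightarrow> (nat \<Rightarrow> real \<Rightarrow> real) \<Rightarrow> nat \<Rightarrow> real \<Rightarrow> real" where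
  "system_rhs m a y j t = (if j < 2 * m - 2 then y (j + 1) t
     else - 1 / a m * (a 0 * y 0 t + (\<Sum>k=1..m - 1. a k * y (2 * k - 1) t)))"

text \<open>Puts the system into Volterra form. Writing \<open>y 0\<close> for \<open>x\<close> in
  the last right-hand side makes it depend on the components alone, so two solutions can be compared
  directly.\<close>

lemma solves_system_integral_form:
  assumes \<beta>: "\<forall>k\<le>2 * m - 2. 0 < \<beta> k \<and> \<beta> k \<le> 1"
    and sol: "solves_system m a \<beta> C x y" and j: "j \<le> 2 * m - 2"
  shows "continuous_on {0..} (system_rhs m a y j)"
    "t \<ge> 0 \<Longrightarrow> y j t = y j 0 + rl_integral (\<beta> j) (restrict_pos (system_rhs m a y j)) t"
proof -
  have cont: "continuous_on {0..} (y i)" if "i \<le> 2 * m - 2" for i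
    by (rule solves_system_continuous[OF sol \<beta> that])
  show c: "continuous_on {0..} (system_rhs m a y j)"
  proof (cases "j < 2 * m - 2")
    case True
    hence "system_rhs m a y j = y (j + 1)" by (simp add: system_rhs_def fun_eq_iff)
    thus ?thesis using cont[of "j + 1"] True by simp
  next
    case False
    hence "system_rhs m a y j = (\<lambda>t. - 1 / a m * (a 0 * y 0 t + (\<Sum>k=1..m - 1. a k * y
      (2 * k - 1) t)))"
      by (simp add: system_rhs_def fun_eq_iff)
    moreover have "continuous_on {0..} \<dots>"
      by (intro continuous_on_mult_left continuous_on_add continuous_on_sum cont) auto
    ultimately show ?thesis by simp
  qed
  have xy: "x t = y 0 t" if "t \<ge> 0" for t using sol that unfolding solves_system_def by blast
  have eq: "caputo (\<beta> j) (y j) t = system_rhs m a y j t" if t: "t > 0" for t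
  proof (cases "j < 2 * m - 2")
    case True
    thus ?thesis using sol t by (simp add: solves_system_def system_rhs_def)
  next
    case False
    hence "j = 2 * m - 2" using j by simp
    moreover have "caputo (\<beta> (2 * m - 2)) (y (2 * m - 2)) t
      = - 1 / a m * (a 0 * x t + (\<Sum>k=1..m - 1. a k * y (2 * k - 1) t))"
      using sol t unfolding solves_system_def by blast
    ultimately show ?thesis using xy[of t] t by (simp add: system_rhs_def)
  qed
  have b: "0 < \<beta> j" "\<beta> j \<le> 1" using \<beta> j by blast+
  have cl: "y j \<in> caputo_class (\<beta> j)" using sol j unfolding solves_system_def by blast
  show "y j t = y j 0 + rl_integral (\<beta> j) (restrict_pos (system_rhs m a y j)) t" if "t \<ge> 0"
    using caputo_inverse[OF cl b c eq that] .
qed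

text \<open>A Lipschitz bound serving all rows at once: the summand 1 covers the rows that shift the
  index, and the sum of coefficient ratios covers the last row.\<close>

lemma system_rhs_diff_le:
  assumes m: "m \<ge> 1"
  shows "\<bar>system_rhs m a y j t - system_rhs m a z j t\<bar>
     \<le> (1 + (\<Sum>k=0..m. \<bar>a k / a m\<bar>)) * (\<Sum>l\<le>2 * m - 2. \<bar>y l t - z l t\<bar>)"
proof -
  define d where "d l = \<bar>y l t - z l t\<bar>" for l
  define S where "S = (\<Sum>l\<le>2 * m - 2. d l)"
  define A where "A = (\<Sum>k=0..m. \<bar>a k / a m\<bar>)"
  have dS: "d l \<le> S" if "l \<le> 2 * m - 2" for l
    unfolding S_def using that by (intro member_le_sum) (auto simp: d_def)
  have S: "0 \<le> S" unfolding S_def by (intro sum_nonneg) (auto simp: d_def)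
  have A: "0 \<le> A" unfolding A_def by (intro sum_nonneg) auto
  have "\<bar>system_rhs m a y j t - system_rhs m a z j t\<bar> \<le> (1 + A) * S"
  proof (cases "j < 2 * m - 2")
    case True
    hence "\<bar>system_rhs m a y j t - system_rhs m a z j t\<bar> = d (j + 1)"
      by (simp add: system_rhs_def d_def)
    also have "\<dots> \<le> S" using True by (intro dS) auto
    also have "\<dots> \<le> (1 + A) * S" using A S by (simp add: distrib_right)
    finally show ?thesis .
  next
    case False
    \<comment> \<open>The component multiplied by \<open>a k\<close> in the last equation, with
      \<open>y 0\<close> in the role of \<open>x\<close> for \<open>k = 0\<close>, so that one sum
      runs over all coefficients.\<close>
    let ?p = "\<lambda>k. if k = 0 then 0 else 2 * k - 1"
    have sum: "a 0 * w 0 t + (\<Sum>k=1..m - 1. a k * w (2 * k - 1) t) = (\<Sum>k=0..m - 1. a k * w (?p k) t)"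
      for w :: "nat \<Rightarrow> real \<Rightarrow> real"
      by (subst (2) sum.atLeast_Suc_atMost) (auto intro!: sum.cong)
    have "system_rhs m a y j t - system_rhs m a z j t
      = - (1 / a m) * ((\<Sum>k=0..m - 1. a k * y (?p k) t) - (\<Sum>k=0..m - 1. a k * z (?p k) t))"
      unfolding system_rhs_def sum using False by (simp add: algebra_simps)
    also have "\<dots> = - (\<Sum>k=0..m - 1. (a k / a m) * (y (?p k) t - z (?p k) t))"
      by (simp add: sum_subtractf[symmetric] sum_distrib_left algebra_simps sum_negf[symmetric]
        diff_divide_distrib)
    finally have "\<bar>system_rhs m a y j t - system_rhs m a z j t\<bar>
      \<le> (\<Sum>k=0..m - 1. \<bar>(a k / a m) * (y (?p k) t - z (?p k) t)\<bar>)"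
      by (simp only: abs_minus_cancel sum_abs)
    also have "\<dots> \<le> (\<Sum>k=0..m - 1. \<bar>a k / a m\<bar> * S)"
    proof (rule sum_mono)
      fix k assume "k \<in> {0..m - 1}"
      hence "?p k \<le> 2 * m - 2" using m by auto
      from dS[OF this] show "\<bar>(a k / a m) * (y (?p k) t - z (?p k) t)\<bar> \<le> \<bar>a k / a m\<bar> * S"
        unfolding abs_mult d_def by (intro mult_left_mono) auto
    qed
    also have "\<dots> = (\<Sum>k=0..m - 1. \<bar>a k / a m\<bar>) * S" by (simp add: sum_distrib_right)
    also have "\<dots> \<le> A * S" unfolding A_def using S by (intro mult_right_mono sum_mono2) auto
    also have "\<dots> \<le> (1 + A) * S" using S by (simp add: distrib_right)
    finally show ?thesis .
  qed
  thus ?thesis unfolding S_def A_def d_def .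
qed

text \<open>The rows are coupled and have different orders, so no single component satisfies a
  closed inequality. The sum \<open>\<phi>\<close> of all differences does, with the kernel
  \<open>\<kappa>\<close> that adds up the kernels of all orders, scaled by the Lipschitz
  constant.\<close>

lemma solves_system_unique:
  assumes m: "m \<ge> 1" and \<beta>: "\<forall>k\<le>2 * m - 2. 0 < \<beta> k \<and> \<beta> k \<le> 1"
    and y: "solves_system m a \<beta> C x y" and z: "solves_system m a \<beta> C x' z"
    and j: "j \<le> 2 * m - 2" and t: "t \<ge> 0"
  shows "y j t = z j t"
proof -
  define M where "M = 1 + (\<Sum>k=0..m. \<bar>a k / a m\<bar>)"
  have M: "M \<ge> 0" unfolding M_def by (intro add_nonneg_nonneg sum_nonneg) auto
  define \<phi> where "\<phi> t = (\<Sum>l\<le>2 * m - 2. \<bar>y l t - z l t\<bar>)" for t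
  define \<kappa> where "\<kappa> s = (\<Sum>l\<le>2 * m - 2. M * rl_kernel (\<beta> l) s)" for s
  have init: "y l 0 = z l 0" if l: "l \<le> 2 * m - 2" for l
  proof (cases "even l")
    case True
    then obtain i where i: "l = 2 * i" by (elim evenE)
    show ?thesis
    proof (cases "i = 0")
      case True thus ?thesis using y z i by (simp add: solves_system_def)
    next
      case False
      hence "i \<in> {1..m - 1}" using i l by auto
      thus ?thesis using y z i by (auto simp: solves_system_def)
    qed
  next
    case False
    then obtain i where i: "l = 2 * i + 1" by (elim oddE)
    have "Suc i \<in> {1..m - 1}" "l = 2 * Suc i - 1" using i l by auto
    thus ?thesis using y z unfolding solves_system_def by metis
  qed
  have \<phi>c: "continuous_on {0..} \<phi>" unfolding \<phi>_def
    by (intro continuous_intros solves_system_continuous[OF y \<beta>] solves_system_continuous[OF z \<beta>])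
      auto
  have \<phi>0: "\<phi> t \<ge> 0" for t unfolding \<phi>_def by (intro sum_nonneg) auto
  have \<kappa>0: "\<kappa> s \<ge> 0" for s unfolding \<kappa>_def using M \<beta>
    by (intro sum_nonneg mult_nonneg_nonneg rl_kernel_nonneg) auto
  have \<kappa>c: "causal_L1 \<kappa>"
  proof -
    have "causal_L1 (rl_kernel (\<beta> l))" if "l \<le> 2 * m - 2" for l using causal_L1_rl_kernel \<beta> that
      by auto
    hence *: "set_integrable lborel {0..t} (rl_kernel (\<beta> l))" if "l \<le> 2 * m - 2" for l t using that
      by (auto simp: causal_L1_def)
    have "set_integrable lborel {0..t} \<kappa>" for t
      unfolding \<kappa>_def[abs_def] set_integrable_def scaleR_sum_right
      using * by (intro Bochner_Integration.integrable_sum) (auto simp: set_integrable_def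
        mult.left_commute)
    moreover have "\<kappa> \<in> borel_measurable borel" unfolding \<kappa>_def[abs_def] by measurable
    moreover have "\<kappa> s = 0" if "s \<le> 0" for s using that by (simp add: \<kappa>_def rl_kernel_eq_0)
    ultimately show ?thesis by (simp add: causal_L1_def)
  qed
  have "\<phi> t \<le> (LINT \<tau>|lborel. \<kappa> (t - \<tau>) * restrict_pos \<phi> \<tau>)" if t: "t \<ge> 0" for t
  proof -
    have "\<phi> t \<le> (\<Sum>l\<le>2 * m - 2. LINT \<tau>|lborel. M * (rl_kernel (\<beta> l) (t - \<tau>) * restrict_pos \<phi> \<tau>))"
      unfolding \<phi>_def[of t]
    proof (rule sum_mono)
      fix l assume "l \<in> {..2 * m - 2}"
      hence l: "l \<le> 2 * m - 2" and b: "\<beta> l > 0" using \<beta> by auto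
      let ?f = "restrict_pos (system_rhs m a y l)" and ?g = "restrict_pos (system_rhs m a z l)"
      note yf = solves_system_integral_form[OF \<beta> y l] and zf = solves_system_integral_form[OF \<beta> z l]
      note yi = integrable_rl_kernel_continuous[OF yf(1) b, of t] and zi
        = integrable_rl_kernel_continuous[OF zf(1) b, of t]
      have "y l t - z l t = rl_integral (\<beta> l) ?f t - rl_integral (\<beta> l) ?g t"
        using yf(2)[OF t] zf(2)[OF t] init[OF l] by simp
      also have "\<dots> = (LINT \<tau>|lborel. rl_kernel (\<beta> l) (t - \<tau>) * ?f \<tau> - rl_kernel (\<beta> l)
        (t - \<tau>) * ?g \<tau>)"
        unfolding rl_integral_def using yi zi by simp
      finally have "\<bar>y l t - z l t\<bar> \<le> (LINT \<tau>|lborel. \<bar>rl_kernel (\<beta> l) (t - \<tau>) * ?f \<tau> - rl_kernel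
        (\<beta> l) (t - \<tau>) * ?g \<tau>\<bar>)"
        by (simp only: integral_abs_bound)
      also have "\<dots> \<le> (LINT \<tau>|lborel. M * (rl_kernel (\<beta> l) (t - \<tau>) * restrict_pos \<phi> \<tau>))"
      proof (rule integral_mono)
        show "integrable lborel (\<lambda>\<tau>. \<bar>rl_kernel (\<beta> l) (t - \<tau>) * ?f \<tau> - rl_kernel (\<beta> l)
          (t - \<tau>) * ?g \<tau>\<bar>)"
          using yi zi by (intro integrable_abs Bochner_Integration.integrable_diff)
        show "integrable lborel (\<lambda>\<tau>. M * (rl_kernel (\<beta> l) (t - \<tau>) * restrict_pos \<phi> \<tau>))"
          by (intro integrable_mult_right integrable_rl_kernel_continuous \<phi>c b)
        fix \<tau>
        have "\<bar>?f \<tau> - ?g \<tau>\<bar> \<le> M * restrict_pos \<phi> \<tau>"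
          using system_rhs_diff_le[OF m, of a y l \<tau> z] by (simp add: restrict_pos_def M_def \<phi>_def)
        hence "\<bar>rl_kernel (\<beta> l) (t - \<tau>)\<bar> * \<bar>?f \<tau> - ?g \<tau>\<bar>
          \<le> \<bar>rl_kernel (\<beta> l) (t - \<tau>)\<bar> * (M * restrict_pos \<phi> \<tau>)"
          by (rule mult_left_mono) simp
        thus "\<bar>rl_kernel (\<beta> l) (t - \<tau>) * ?f \<tau> - rl_kernel (\<beta> l) (t - \<tau>) * ?g \<tau>\<bar>
          \<le> M * (rl_kernel (\<beta> l) (t - \<tau>) * restrict_pos \<phi> \<tau>)"
          using rl_kernel_nonneg[OF b] by (simp add: right_diff_distrib[symmetric] abs_mult mult_ac)
      qed
      finally show "\<bar>y l t - z l t\<bar> \<le> (LINT \<tau>|lborel. M * (rl_kernel (\<beta> l) (t - \<tau>) * restrict_pos \<phi>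
        \<tau>))" .
    qed
    also have "\<dots> = (LINT \<tau>|lborel. (\<Sum>l\<le>2 * m - 2. M * (rl_kernel (\<beta> l) (t - \<tau>) * restrict_pos \<phi>
      \<tau>)))"
      using \<beta> by (intro Bochner_Integration.integral_sum[symmetric] integrable_mult_right
        integrable_rl_kernel_continuous \<phi>c) auto
    also have "\<dots> = (LINT \<tau>|lborel. \<kappa> (t - \<tau>) * restrict_pos \<phi> \<tau>)"
      by (simp add: \<kappa>_def sum_distrib_right mult.assoc)
    finally show ?thesis .
  qed
  from volterra_unique[OF \<phi>c \<phi>0 \<kappa>c \<kappa>0 this t] have "\<phi> t = 0" by simp
  hence "\<bar>y j t - z j t\<bar> = 0" unfolding \<phi>_def using j by (subst (asm) sum_nonneg_eq_0_iff) auto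
  thus ?thesis by simp
qed

theorem theorem5p1:
  fixes m :: nat and a \<alpha> \<beta> :: "nat \<Rightarrow> real"
  assumes "m \<ge> 1"
    and "a m \<noteq> 0"
    and "\<forall>k\<in>{1..m}. real k - 1 < \<alpha> k \<and> \<alpha> k \<le> real k"
    and "\<forall>j<m. \<beta> (2 * j) = \<alpha> (j + 1) - real j"
    and "\<forall>j<m - 1. \<beta> (2 * j + 1) = real (j + 1) - \<alpha> (j + 1)"
    and "\<forall>k\<le>2 * m - 2. 0 < \<beta> k \<and> \<beta> k \<le> 1"
  shows "\<forall>C :: nat \<Rightarrow> real.
      (\<forall>x. solves_multiterm m a \<alpha> C x \<longleftrightarrow> (\<exists>y. solves_system m a \<beta> C x y)) \<and>
      (\<forall>x x' y. solves_multiterm m a \<alpha> C x \<and> solves_system m a \<beta> C x' y \<longrightarrow>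
         (\<forall>t\<ge>0. x t = y 0 t))"
proof (intro allI conjI impI)
  note to_system = solves_multiterm_imp_system[where m=m and a=a and \<alpha>=\<alpha> and \<beta>=\<beta>, OF assms]
  note to_multiterm = solves_system_imp_multiterm[where m=m and a=a and \<alpha>=\<alpha> and \<beta>=\<beta>, OF assms]
  {
    fix C x
    show "solves_multiterm m a \<alpha> C x \<longleftrightarrow> (\<exists>y. solves_system m a \<beta> C x y)"
      using to_system[of C x] to_multiterm[of C x] by blast
  }
  fix C x x' y and t :: real
  assume *: "solves_multiterm m a \<alpha> C x \<and> solves_system m a \<beta> C x' y" and t: "0 \<le> t"
  \<comment> \<open>The given \<open>y\<close> belongs to a possibly different \<open>x'\<close>.
    The companion system \<open>z\<close> of \<open>x\<close> has the same initial data, and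
    uniqueness identifies its component 0, which is \<open>x\<close>, with
    \<open>y 0\<close>.\<close>
  from * obtain z where z: "solves_system m a \<beta> C x z" "z 0 = x"
    using to_system[of C x] by blast
  show "x t = y 0 t"
    using solves_system_unique[OF assms(1,6) z(1) conjunct2[OF *] _ t, of 0] z(2) by simp
qed

end
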